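(* Let $n\ge 3$, let $(f,\Gamma)$ be a normalized admissible pair with $f$ concave on $\Gamma$, and suppose $\mu_\Gamma^+\le 1$. Then there exists a one-parameter family $\{w^{(a)}\}_{a\ge 0}$ of smooth positive solutions, each depending only on $x_n$ (written $w^{(a)}=w^{(a)}(x_n)$), to $$\begin{cases} f(\lambda(-A_w))=\tfrac12,\quad \lambda(-A_w)\in\Gamma & \text{in }\mathbb{R}^n_+,\\ w=0 & \text{on }\partial\mathbb{R}^n_+,\end{cases}$$ satisfying the following six properties: 1. $w^{(0)}(x_n)=x_n$; 2. $w^{(a)}(1)=1+a$; 3. $(w^{(a)})'\ge 1$ (and hence $w^{(a)}(x_n)\ge x_n$) and $(w^{(a)})'(0)=1$; 4. $(w^{(a)})''\ge 0$; 5. if $0\le a<b$ then $w^{(a)}(x_n)<w^{(b)}(x_n)$ for all $x_n>0$; 6. the metric $g_{w^{(a)}}$ is locally complete near $\partial\mathbb{R}^n_+$ for all $a\ge 0$, but is incomplete on $\mathbb{R}^n_+$ for all $a>0$.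
   Context: $\mathbb{R}^n_+=\{x\in\mathbb{R}^n: x_n>0\}$. For a positive $C^2$ function $w$, $g_w=w^{-2}|dx|^2$ and $A_w=w\nabla^2 w-\tfrac12|\nabla w|^2 I$ (the $(1,1)$-Schouten tensor of $g_w$), where $\nabla,\nabla^2$ are Euclidean; $\lambda(-A_w)\in\mathbb{R}^n$ denotes the vector of eigenvalues of $-A_w$. A normalized admissible pair $(f,\Gamma)$ means: $\Gamma\subset\mathbb{R}^n$ is an open, convex, connected, symmetric (permutation-invariant) cone with vertex at $0$; $\Gamma_n^+\subseteq\Gamma\subseteq\Gamma_1^+$, where $\Gamma_n^+=\{\lambda:\lambda_i>0\ \forall i\}$ and $\Gamma_1^+=\{\lambda:\lambda_1+\dots+\lambda_n>0\}$; $f\in C^\infty(\Gamma)\cap C^0(\overline\Gamma)$ is homogeneous of degree one and symmetric in the $\lambda_i$; $f>0$ in $\Gamma$, $f=0$ on $\partial\Gamma$, $\partial f/\partial\lambda_i>0$ in $\Gamma$ for each $i$; and $f(e)=1$ where $e=(1,\dots,1)$. $\mu_\Gamma^+\in[0,n-1]$ is the unique number with $(-\mu_\Gamma^+,1,\dots,1)\in\partial\Gamma$. Local completeness of $g_w$ near $\partial\mathbb{R}^n_+$ means: for every $x\in\partial\mathbb{R}^n_+$ and every neighbourhood $U$ of $x$ in $\overline{\mathbb{R}^n_+}$, any geodesic emanating from a point in $U$ which does not exit $U$ can be extended indefinitely.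
   Formalization: In the definition of local completeness near the boundary, the neighbourhoods U are taken to be bounded; with arbitrary U (for instance the whole closed half-space) local completeness would be completeness, and property 6 would contradict itself for a > 0. *)

theory Defs
  imports "HOL-Analysis.Analysis"
begin

section \<open>Partial derivatives and smoothness\<close>

definition pderivative :: "'n::finite \<Rightarrow> (real ^ 'n \<Rightarrow> real) \<Rightarrow> real ^ 'n \<Rightarrow> real" where
  "pderivative i u x = deriv (\<lambda>s. u (x + s *\<^sub>R axis i 1)) 0"

text \<open>Meant for open sets \<open>S\<close> only.\<close>

primrec Ck_on :: "nat \<Rightarrow> (real ^ 'n::finite \<Rightarrow> real) \<Rightarrow> (real ^ 'n) set \<Rightarrow> bool" where
  "Ck_on 0 u S \<longleftrightarrow> continuous_on S u"
| "Ck_on (Suc m) u S \<longleftrightarrow>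
     (\<forall>x\<in>S. u differentiable (at x)) \<and> (\<forall>i. Ck_on m (pderivative i u) S)"

definition smooth_on :: "(real ^ 'n::finite \<Rightarrow> real) \<Rightarrow> (real ^ 'n) set \<Rightarrow> bool" where
  "smooth_on u S \<longleftrightarrow> (\<forall>m. Ck_on m u S)"

definition grad :: "(real ^ 'n::finite \<Rightarrow> real) \<Rightarrow> real ^ 'n \<Rightarrow> real ^ 'n" where
  "grad u x = (\<chi> i. pderivative i u x)"

definition hessian :: "(real ^ 'n::finite \<Rightarrow> real) \<Rightarrow> real ^ 'n \<Rightarrow> real ^ 'n ^ 'n" where
  "hessian u x = (\<chi> i j. pderivative i (pderivative j u) x)"

section \<open>The Schouten tensor and its eigenvalues\<close>

definition schouten :: "(real ^ 'n::finite \<Rightarrow> real) \<Rightarrow> real ^ 'n \<Rightarrow> real ^ 'n ^ 'n" where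
  "schouten w x = w x *\<^sub>R hessian w x - (1 / 2 * (norm (grad w x))\<^sup>2) *\<^sub>R mat 1"

text \<open>
  The eigenvalues are listed with algebraic multiplicity, as the roots of the characteristic
  polynomial. The choice operator fixes one of their orderings; every use below is
  permutation invariant.
\<close>

definition eigenvalues :: "real ^ 'n ^ 'n::finite \<Rightarrow> real ^ 'n" where
  "eigenvalues M = (SOME l. \<forall>t. det (mat t - M) = (\<Prod>i\<in>UNIV. t - l $ i))"

section \<open>Normalized admissible pairs\<close>

definition Gamma_n :: "(real ^ 'n::finite) set" where
  "Gamma_n = {l. \<forall>i. l $ i > 0}"

definition Gamma_1 :: "(real ^ 'n::finite) set" where
  "Gamma_1 = {l. (\<Sum>i\<in>UNIV. l $ i) > 0}"

definition admissible_cone :: "(real ^ 'n::finite) set \<Rightarrow> bool" where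
  "admissible_cone \<Gamma> \<longleftrightarrow>
     open \<Gamma> \<and> convex \<Gamma> \<and> connected \<Gamma> \<and>
     (\<forall>c>0. \<forall>l\<in>\<Gamma>. c *\<^sub>R l \<in> \<Gamma>) \<and>
     (\<forall>\<sigma>. bij \<sigma> \<longrightarrow> (\<forall>l\<in>\<Gamma>. (\<chi> i. l $ \<sigma> i) \<in> \<Gamma>)) \<and>
     Gamma_n \<subseteq> \<Gamma> \<and> \<Gamma> \<subseteq> Gamma_1"

definition normalized_admissible_pair ::
    "(real ^ 'n::finite \<Rightarrow> real) \<Rightarrow> (real ^ 'n) set \<Rightarrow> bool" where
  "normalized_admissible_pair f \<Gamma> \<longleftrightarrow>
     admissible_cone \<Gamma> \<and>
     smooth_on f \<Gamma> \<and> continuous_on (closure \<Gamma>) f \<and>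
     (\<forall>c>0. \<forall>l\<in>closure \<Gamma>. f (c *\<^sub>R l) = c * f l) \<and>
     (\<forall>\<sigma>. bij \<sigma> \<longrightarrow> (\<forall>l\<in>closure \<Gamma>. f (\<chi> i. l $ \<sigma> i) = f l)) \<and>
     (\<forall>l\<in>\<Gamma>. f l > 0) \<and> (\<forall>l\<in>frontier \<Gamma>. f l = 0) \<and>
     (\<forall>i. \<forall>l\<in>\<Gamma>. pderivative i f l > 0) \<and>
     f (\<chi> i. 1) = 1"

text \<open>
  An index type has no first element, so the slot of \<open>- \<mu>\<close> is arbitrary; for a symmetric
  cone all slots give the same condition.
\<close>

definition mu_plus :: "(real ^ 'n::finite) set \<Rightarrow> real" where
  "mu_plus \<Gamma> = (THE \<mu>. \<mu> \<in> {0 .. real CARD('n) - 1} \<and>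
     (\<forall>i. (\<chi> j. if j = i then - \<mu> else 1) \<in> frontier \<Gamma>))"

section \<open>Geodesics and completeness\<close>

text \<open>A Riemannian metric is given by its coefficient matrix \<open>g x $ i $ j\<close>.\<close>

definition christoffel ::
    "(real ^ 'n::finite \<Rightarrow> real ^ 'n ^ 'n) \<Rightarrow> real ^ 'n \<Rightarrow> 'n \<Rightarrow> 'n \<Rightarrow> 'n \<Rightarrow> real" where
  "christoffel g x m i j =
     1 / 2 * (\<Sum>l\<in>UNIV. matrix_inv (g x) $ m $ l *
       (pderivative i (\<lambda>y. g y $ j $ l) x + pderivative j (\<lambda>y. g y $ i $ l) x
        - pderivative l (\<lambda>y. g y $ i $ j) x))"

definition geodesic_on ::
    "(real ^ 'n::finite \<Rightarrow> real ^ 'n ^ 'n) \<Rightarrow> (real ^ 'n) set \<Rightarrow> real set \<Rightarrow> (real \<Rightarrow> real ^ 'n) \<Rightarrow> bool"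
  where
  "geodesic_on g M I c \<longleftrightarrow> c ` I \<subseteq> M \<and>
     (\<exists>v. (\<forall>t\<in>I. (c has_vector_derivative v t) (at t within I)) \<and>
          (\<forall>t\<in>I. (v has_vector_derivative
              (\<chi> m. - (\<Sum>i\<in>UNIV. \<Sum>j\<in>UNIV. christoffel g (c t) m i j * v t $ i * v t $ j)))
            (at t within I)))"

text \<open>The half-open interval from \<open>0\<close> to \<open>T\<close>, where \<open>T = \<infinity>\<close> is allowed.\<close>

definition time_interval :: "ereal \<Rightarrow> real set" where
  "time_interval T = {t. 0 \<le> t \<and> ereal t < T}"

text \<open>
  A geodesic emanating from \<open>c 0\<close>, already extended forward in time as far as possible
  inside \<open>M\<close>; it can be extended indefinitely iff \<open>T = \<infinity>\<close>.
\<close>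

definition maximal_geodesic ::
    "(real ^ 'n::finite \<Rightarrow> real ^ 'n ^ 'n) \<Rightarrow> (real ^ 'n) set \<Rightarrow> ereal \<Rightarrow> (real \<Rightarrow> real ^ 'n) \<Rightarrow> bool"
  where
  "maximal_geodesic g M T c \<longleftrightarrow> 0 < T \<and> geodesic_on g M (time_interval T) c \<and>
     \<not> (\<exists>T' c'. T < T' \<and> geodesic_on g M (time_interval T') c' \<and>
          (\<forall>t\<in>time_interval T. c' t = c t))"

definition complete_metric ::
    "(real ^ 'n::finite \<Rightarrow> real ^ 'n ^ 'n) \<Rightarrow> (real ^ 'n) set \<Rightarrow> bool" where
  "complete_metric g M \<longleftrightarrow> (\<forall>T c. maximal_geodesic g M T c \<longrightarrow> T = \<infinity>)"

text \<open>
  The neighbourhoods \<open>U\<close> are bounded: \<open>closure M\<close> itself is a neighbourhood of each of its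
  points, and admitting it would turn the condition into completeness on all of \<open>M\<close>.
\<close>

definition locally_complete_near_boundary ::
    "(real ^ 'n::finite \<Rightarrow> real ^ 'n ^ 'n) \<Rightarrow> (real ^ 'n) set \<Rightarrow> bool" where
  "locally_complete_near_boundary g M \<longleftrightarrow>
     (\<forall>x\<in>frontier M. \<forall>U V. U \<subseteq> closure M \<and> bounded U \<and>
        openin (top_of_set (closure M)) V \<and> x \<in> V \<and> V \<subseteq> U \<longrightarrow>
        (\<forall>T c. maximal_geodesic g M T c \<and> c ` time_interval T \<subseteq> U \<longrightarrow> T = \<infinity>))"

section \<open>The equation on the half-space\<close>

definition conformal_metric :: "(real ^ 'n::finite \<Rightarrow> real) \<Rightarrow> real ^ 'n \<Rightarrow> real ^ 'n ^ 'n" where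
  "conformal_metric w x = (1 / (w x)\<^sup>2) *\<^sub>R mat 1"

text \<open>The index \<open>k\<close> is the one written \<open>n\<close> in \<open>x\<^sub>n\<close>.\<close>

definition half_space :: "'n::finite \<Rightarrow> (real ^ 'n) set" where
  "half_space k = {x. x $ k > 0}"

definition smooth_positive_solution ::
    "(real ^ 'n::finite \<Rightarrow> real) \<Rightarrow> (real ^ 'n) set \<Rightarrow> 'n \<Rightarrow> (real ^ 'n \<Rightarrow> real) \<Rightarrow> bool" where
  "smooth_positive_solution f \<Gamma> k w \<longleftrightarrow>
     smooth_on w (half_space k) \<and> continuous_on (closure (half_space k)) w \<and>
     (\<forall>x\<in>half_space k. w x > 0 \<and>
        eigenvalues (- schouten w x) \<in> \<Gamma> \<and> f (eigenvalues (- schouten w x)) = 1 / 2) \<and>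
     (\<forall>x\<in>frontier (half_space k). w x = 0)"

end

theory Submission
  imports Defs
begin

text \<open>
  If \<open>w\<close> depends on \<open>x\<^sub>n\<close> only, then \<open>- A\<^sub>w\<close> is diagonal, with the entry \<open>w'\<^sup>2 / 2 - w w''\<close> in the
  direction of \<open>x\<^sub>n\<close> and \<open>w'\<^sup>2 / 2\<close> in the others. Put \<open>p = w'\<close>, \<open>s = 1 - 2 w w'' / p\<^sup>2\<close> and
  \<open>h(s) = f(s, 1, \<dots>, 1)\<close>. By homogeneity of \<open>f\<close> the equation becomes \<open>p\<^sup>2 h(s) = 1\<close>. The function
  \<open>h\<close> increases from \<open>h(- \<mu>) = 0\<close> to \<open>h(1) = 1\<close>, where \<open>\<mu> = \<mu>\<^sub>\<Gamma>\<^sup>+\<close>, so the slope \<open>p \<ge> 1\<close> and the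
  parameter \<open>s \<le> 1\<close> determine each other, and the constant solution \<open>s = 1\<close> is \<open>w = x\<^sub>n\<close>. The locale
  \<open>profile\<close> is this reduction.

  A second solution is found by quadrature, with \<open>s\<close> as the independent variable: the equations read
  \<open>dw / w = - h' / (h (1 - s)) ds\<close> and \<open>dx = sqrt h dw\<close>. As \<open>s\<close> decreases from \<open>1\<close> to \<open>- \<mu>\<close>, both
  \<open>w\<close> and \<open>x\<close> run from \<open>0\<close> to infinity. For \<open>x\<close> this depends on \<open>\<mu> \<le> 1\<close>: then
  \<open>1 - s \<le> 2\<close>, whence \<open>w sqrt h\<close> is nonincreasing in \<open>s\<close> and the slope grows at most linearly in \<open>w\<close>, so the
  solution does not blow up at a finite height (\<open>slope_equation_by_quadrature\<close>,
  \<open>nontrivial_profile_exists\<close>). The solution is smooth because \<open>w\<close>, \<open>p\<close>, \<open>s\<close> and the derivatives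
  of \<open>h\<close> at \<open>s\<close> generate an algebra of functions closed under differentiation.

  The equation is invariant under \<open>w(x) \<mapsto> w(r x) / r\<close>. For the nontrivial solution \<open>u\<close>, the ratio
  \<open>u(x) / x\<close> increases strictly from \<open>1\<close> to infinity, since \<open>u\<close> is strictly convex with slope \<open>1\<close> at
  \<open>0\<close> and unbounded slope. So for \<open>a > 0\<close> exactly one dilation takes the value \<open>1 + a\<close> at \<open>1\<close>, and the dilations are
  ordered by \<open>a\<close> (\<open>ratio_less\<close>, \<open>ratio_surj\<close>).

  For the completeness statements, a geodesic \<open>c\<close> has constant \<open>|c'| / w\<close>, and \<open>w\<close> is at most a
  multiple of \<open>x\<^sub>n\<close> on bounded sets. Hence a geodesic that stays bounded keeps a positive distance from the
  boundary for finite times and can be continued by the Picard-Lindeloef theorem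
  (\<open>bounded_maximal_geodesic_is_complete\<close>). The vertical geodesic, on the other hand, has finite length
  \<open>\<integral> dx / w\<close> towards infinity when \<open>a > 0\<close>, because eventually \<open>dx / w \<le> - 4 d(1 / p)\<close> (\<open>incomplete\<close>).
\<close>

section \<open>Continuation of solutions of ordinary differential equations\<close>

text \<open>
  The finite exceptional set matters: a function glued from two solutions of an ODE at a time \<open>T\<close>
  is differentiable off \<open>T\<close> at first sight only. Both sides of the fundamental theorem of
  calculus make sense nevertheless, and differentiating the integral gives the derivative at the
  exceptional points and the one-sided derivatives at the end points.
\<close>

lemma has_vector_derivative_Icc_of_interior:
  fixes z g :: "real \<Rightarrow> 'a::banach"
  assumes "finite S" and z: "continuous_on {a..b} z" and g: "continuous_on {a..b} g"
    and deriv: "\<And>t. t \<in> {a<..<b} - S \<Longrightarrow> (z has_vector_derivative g t) (at t)"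
    and t: "t \<in> {a..b}"
  shows "(z has_vector_derivative g t) (at t within {a..b})"
proof -
  have eq: "z a + integral {a..x} g = z x" if "x \<in> {a..b}" for x
  proof -
    have "(g has_integral (z x - z a)) {a..x}"
      using that by (intro fundamental_theorem_of_calculus_interior_strong[OF \<open>finite S\<close>] deriv
          continuous_on_subset[OF z]) auto
    then show ?thesis
      by (simp add: integral_unique)
  qed
  have "((\<lambda>x. z a + integral {a..x} g) has_vector_derivative g t) (at t within {a..b})"
    using integral_has_vector_derivative[OF g t]
    by (auto intro!: derivative_eq_intros)
  then show ?thesis
    by (rule has_vector_derivative_transform[OF t, rotated]) (simp add: eq)
qed

text \<open>
  Banach's fixed point theorem for the integral operator on all bounded continuous functions.
  Two truncations make that space suitable: the field is composed with the nearest-point projection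
  to the ball, so that it becomes globally Lipschitz and bounded, and time is clamped to \<open>{0..e}\<close>.
  For small \<open>e\<close> the fixed point stays in the ball, where the projection does nothing.
\<close>

lemma picard_lindelof:
  fixes F :: "'a::euclidean_space \<Rightarrow> 'a"
  assumes "r > 0" and lip: "L-lipschitz_on (cball x0 r) F"
  shows "\<exists>e>0. \<exists>z. z 0 = x0 \<and>
    (\<forall>t\<in>{0..e}. z t \<in> cball x0 r \<and> (z has_vector_derivative F (z t)) (at t within {0..e}))"
proof -
  define proj where "proj = closest_point (cball x0 r)"
  define G where "G = F \<circ> proj"
  have L: "L \<ge> 0"
    using lip by (rule lipschitz_on_nonneg)
  have proj: "proj x \<in> cball x0 r" for x
    unfolding proj_def using \<open>r > 0\<close> by (intro closest_point_in_set) auto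
  have G_lip: "dist (G x) (G y) \<le> L * dist x y" for x y
  proof -
    have "dist (G x) (G y) \<le> L * dist (proj x) (proj y)"
      using lipschitz_onD[OF lip proj proj] by (simp add: G_def)
    also have "\<dots> \<le> L * dist x y"
      unfolding proj_def using \<open>r > 0\<close> L by (intro mult_left_mono closest_point_lipschitz) auto
    finally show ?thesis .
  qed
  have G_cont: "continuous_on A G" for A
    by (rule lipschitz_on_continuous_on[of L]) (auto intro!: lipschitz_onI G_lip L)
  define B where "B = norm (F x0) + L * r"
  have G_bound: "norm (G x) \<le> B" for x
  proof -
    have "dist (G x) (F x0) \<le> L * dist (proj x) x0"
      using lipschitz_onD[OF lip proj, of x0 x] \<open>r > 0\<close> by (simp add: G_def)
    also have "\<dots> \<le> L * r"
      using proj[of x] L by (intro mult_left_mono) (auto simp: dist_commute)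
    finally show ?thesis
      using norm_triangle_ineq2[of "G x" "F x0"] by (simp add: B_def dist_norm)
  qed
  have B: "B \<ge> 0"
    using G_bound[of x0] norm_ge_zero order_trans by blast
  \<comment> \<open>The first bound keeps the fixed point in the ball, the second makes the operator a contraction.\<close>
  define e where "e = min (r / (B + 1)) (1 / (2 * (L + 1)))"
  have e: "e > 0" "B * e \<le> r" "e * L \<le> 1 / 2"
  proof -
    show "e > 0"
      using \<open>r > 0\<close> B L by (simp add: e_def)
    have "B * e \<le> B * (r / (B + 1))"
      using B by (intro mult_left_mono) (auto simp: e_def)
    also have "\<dots> \<le> r"
      using B \<open>r > 0\<close> by (simp add: field_simps)
    finally show "B * e \<le> r" .
    have "e * L \<le> 1 / (2 * (L + 1)) * L"
      using L by (intro mult_right_mono) (auto simp: e_def)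
    also have "\<dots> \<le> 1 / 2"
      using L by (simp add: field_simps)
    finally show "e * L \<le> 1 / 2" .
  qed
  define clamp where "clamp t = max 0 (min e t)" for t
  have clamp: "clamp t \<in> {0..e}" for t
    using e by (auto simp: clamp_def)
  have cont_comp: "continuous_on A (\<lambda>t. G (apply_bcontfun z t))" for A z
    by (rule continuous_on_compose2[OF G_cont[of UNIV]]) auto
  define T where "T z t = x0 + integral {0..clamp t} (\<lambda>s. G (apply_bcontfun z s))"
    for z :: "real \<Rightarrow>\<^sub>C 'a" and t
  have T_dist: "norm (T z t - x0) \<le> r" for z t
  proof -
    have "norm (integral {0..clamp t} (\<lambda>s. G (apply_bcontfun z s))) \<le> B * (clamp t - 0)"
      using clamp[of t] by (intro integral_bound cont_comp G_bound) auto
    also have "\<dots> \<le> B * e"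
      using clamp[of t] B by (intro mult_left_mono) auto
    finally show ?thesis
      using e by (simp add: T_def)
  qed
  have T_bcont: "T z \<in> bcontfun" for z
  proof -
    have "continuous_on {0..e} (\<lambda>t. integral {0..t} (\<lambda>s. G (apply_bcontfun z s)))"
      by (intro indefinite_integral_continuous_1 integrable_continuous_interval cont_comp)
    then have "continuous_on UNIV (\<lambda>t. integral {0..clamp t} (\<lambda>s. G (apply_bcontfun z s)))"
      by (rule continuous_on_compose2) (use clamp in \<open>auto simp: clamp_def intro!: continuous_intros\<close>)
    then have "continuous_on UNIV (T z)"
      unfolding T_def by (intro continuous_intros)
    moreover have "bounded (range (T z))"
    proof (rule boundedI)
      fix x assume "x \<in> range (T z)"
      then obtain t where "x = T z t"
        by auto
      then show "norm x \<le> norm x0 + r"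
        using T_dist[of z t] norm_triangle_sub[of x x0] by simp
    qed
    ultimately show ?thesis
      by (simp add: bcontfun_def)
  qed
  have app: "apply_bcontfun (Bcontfun (T z)) = T z" for z
    using T_bcont by (rule Bcontfun_inverse)
  have contr: "dist (Bcontfun (T y)) (Bcontfun (T z)) \<le> 1 / 2 * dist y z" for y z
  proof (rule dist_bound)
    fix t
    have "dist (T y t) (T z t)
        = norm (integral {0..clamp t} (\<lambda>s. G (apply_bcontfun y s) - G (apply_bcontfun z s)))"
      unfolding T_def dist_norm
      by (subst integral_diff) (auto intro!: integrable_continuous_interval cont_comp)
    also have "\<dots> \<le> L * dist y z * (clamp t - 0)"
    proof (rule integral_bound)
      fix s
      have "norm (G (apply_bcontfun y s) - G (apply_bcontfun z s))
          \<le> L * dist (apply_bcontfun y s) (apply_bcontfun z s)"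
        using G_lip by (simp add: dist_norm)
      also have "\<dots> \<le> L * dist y z"
        using L by (intro mult_left_mono dist_bounded)
      finally show "norm (G (apply_bcontfun y s) - G (apply_bcontfun z s)) \<le> L * dist y z" .
    qed (use clamp[of t] in \<open>auto intro!: continuous_intros cont_comp\<close>)
    also have "\<dots> \<le> L * dist y z * e"
      using clamp[of t] L by (intro mult_left_mono) auto
    also have "\<dots> = (e * L) * dist y z"
      by simp
    also have "\<dots> \<le> 1 / 2 * dist y z"
      using e by (intro mult_right_mono) auto
    finally show "dist (apply_bcontfun (Bcontfun (T y)) t) (apply_bcontfun (Bcontfun (T z)) t)
        \<le> 1 / 2 * dist y z"
      by (simp add: app)
  qed
  obtain z where "Bcontfun (T z) = z"
    using banach_fix_type[of "1/2" "\<lambda>z. Bcontfun (T z)"] contr by auto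
  then have z: "T z t = apply_bcontfun z t" for t
    using app[of z] by simp
  have z_ball: "apply_bcontfun z t \<in> cball x0 r" for t
    using T_dist[of z t] by (simp add: z dist_norm norm_minus_commute)
  then have G_eq: "G (apply_bcontfun z t) = F (apply_bcontfun z t)" for t
    by (simp add: G_def proj_def closest_point_self)
  show ?thesis
  proof (intro exI[of _ e] conjI exI[of _ "apply_bcontfun z"] ballI z_ball)
    show "apply_bcontfun z 0 = x0"
      using e z[of 0] by (simp add: T_def clamp_def)
    fix t assume t: "t \<in> {0..e}"
    have "((\<lambda>t. x0 + integral {0..t} (\<lambda>s. G (apply_bcontfun z s)))
        has_vector_derivative G (apply_bcontfun z t)) (at t within {0..e})"
      using integral_has_vector_derivative[OF cont_comp t] by (auto intro!: derivative_eq_intros)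
    then show "(apply_bcontfun z has_vector_derivative F (apply_bcontfun z t)) (at t within {0..e})"
      unfolding G_eq
    proof (rule has_vector_derivative_transform[OF t, rotated])
      fix s assume "s \<in> {0..e}"
      then have "clamp s = s"
        by (simp add: clamp_def)
      then show "apply_bcontfun z s = x0 + integral {0..s} (\<lambda>s. F (apply_bcontfun z s))"
        using z[of s] by (simp add: T_def G_eq)
    qed
  qed (use e in auto)
qed

text \<open>
  A solution confined to a compact set has bounded speed, hence a limit at the final time, and can be
  restarted from that limit. The set \<open>D\<close> collects the points at which the field is meaningful; the
  extended solution must not leave it.
\<close>

lemma ode_solution_extends:
  fixes F :: "'a::euclidean_space \<Rightarrow> 'a"
  assumes "compact K" and lip: "\<And>x. x \<in> K \<Longrightarrow> \<exists>r>0. \<exists>L. cball x r \<subseteq> D \<and> L-lipschitz_on (cball x r) F"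
    and "T > 0"
    and z: "\<And>t. t \<in> {0..<T} \<Longrightarrow> z t \<in> K \<and> (z has_vector_derivative F (z t)) (at t within {0..<T})"
  shows "\<exists>T'>T. \<exists>z'. (\<forall>t\<in>{0..<T}. z' t = z t) \<and>
    (\<forall>t\<in>{0..<T'}. z' t \<in> D \<and> (z' has_vector_derivative F (z' t)) (at t within {0..<T'}))"
proof -
  have contF: "continuous (at x) F" if x: "x \<in> K" for x
  proof -
    obtain r L where "r > 0" "L-lipschitz_on (cball x r) F"
      using lip[OF x] by blast
    then have "continuous_on (ball x r) F"
      using lipschitz_on_continuous_on lipschitz_on_subset ball_subset_cball by blast
    then show ?thesis
      using \<open>r > 0\<close> by (simp add: continuous_on_eq_continuous_at)
  qed
  then have contK: "continuous_on K F"
    by (simp add: continuous_at_imp_continuous_on)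
  then have "bounded (F ` K)"
    using \<open>compact K\<close> by (intro compact_imp_bounded compact_continuous_image)
  then obtain B where B: "B > 0" "\<And>x. x \<in> K \<Longrightarrow> norm (F x) \<le> B"
    unfolding bounded_pos by auto
  have "B-lipschitz_on {0..<T} z"
  proof (rule bounded_derivative_imp_lipschitz)
    fix t assume t: "t \<in> {0..<T}"
    then show "(z has_derivative (\<lambda>h. h *\<^sub>R F (z t))) (at t within {0..<T})"
      using z[of t] by (simp add: has_vector_derivative_def)
    show "onorm (\<lambda>h. h *\<^sub>R F (z t)) \<le> B"
    proof (rule onorm_le)
      fix h :: real
      have "\<bar>h\<bar> * norm (F (z t)) \<le> \<bar>h\<bar> * B"
        using B z[of t] t by (intro mult_left_mono) auto
      then show "norm (h *\<^sub>R F (z t)) \<le> B * norm h"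
        by (simp add: mult.commute)
    qed
  qed (use B in auto)
  then obtain Z where Z: "B-lipschitz_on (closure {0..<T}) Z" "\<And>t. t \<in> {0..<T} \<Longrightarrow> Z t = z t"
    using lipschitz_extend_closure by blast
  then have Zcont: "continuous_on {0..T} Z"
    using lipschitz_on_continuous_on[OF Z(1)] \<open>T > 0\<close> by simp
  have ZK: "Z t \<in> K" if "t \<in> {0..T}" for t
  proof -
    have cl: "closure {0..<T} = {0..T}"
      using \<open>T > 0\<close> by simp
    have "Z ` closure {0..<T} \<subseteq> K"
      using Zcont Z(2) z \<open>compact K\<close> compact_imp_closed
      by (intro image_closure_subset) (auto simp: cl)
    then show ?thesis
      using that unfolding cl by blast
  qed
  obtain r L where r: "r > 0" "cball (Z T) r \<subseteq> D" "L-lipschitz_on (cball (Z T) r) F"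
    using lip[OF ZK[of T]] \<open>T > 0\<close> by auto
  obtain e y where e: "e > 0" and y0: "y 0 = Z T"
    and y: "\<And>t. t \<in> {0..e} \<Longrightarrow> y t \<in> cball (Z T) r \<and> (y has_vector_derivative F (y t)) (at t within {0..e})"
    using picard_lindelof[OF r(1,3)] by auto
  define z' where "z' t = (if t \<le> T then Z t else y (t - T))" for t
  have z'1: "z' t = Z t" if "t \<le> T" for t
    using that by (simp add: z'_def)
  have z'2: "z' t = y (t - T)" if "t \<ge> T" for t
    using that y0 by (cases "t = T") (auto simp: z'_def)
  have ycont: "continuous_on {0..e} y"
    using y by (intro continuous_on_vector_derivative) auto
  have "continuous_on {T..T + e} (\<lambda>t. y (t - T))"
    by (rule continuous_on_compose2[OF ycont]) (auto intro!: continuous_intros)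
  then have "continuous_on ({0..T} \<union> {T..T + e}) z'"
    using Zcont z'1 z'2
    by (intro continuous_on_closed_Un) (auto elim: continuous_on_eq)
  then have z'cont: "continuous_on {0..T + e} z'"
    using \<open>T > 0\<close> e by (simp add: ivl_disj_un_two_touch)
  have z'_in: "z' t \<in> K \<or> z' t \<in> cball (Z T) r" if "t \<in> {0..T + e}" for t
    using that y[of "t - T"] ZK[of t] by (auto simp: z'_def)
  have z'D: "z' t \<in> D" if "t \<in> {0..T + e}" for t
  proof -
    have "K \<subseteq> D"
    proof
      fix x assume "x \<in> K"
      then obtain r where "r > 0" "cball x r \<subseteq> D"
        using lip by blast
      then show "x \<in> D"
        by auto
    qed
    then show ?thesis
      using z'_in[OF that] r by blast
  qed
  have "continuous_on (Z ` {0..T} \<union> cball (Z T) r) F"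
  proof (rule continuous_on_closed_Un)
    show "closed (Z ` {0..T})"
      using compact_continuous_image[OF Zcont] compact_imp_closed by auto
    show "continuous_on (Z ` {0..T}) F"
      using ZK by (intro continuous_on_subset[OF contK]) auto
    show "continuous_on (cball (Z T) r) F"
      using r lipschitz_on_continuous_on by blast
  qed auto
  moreover have "z' ` {0..T + e} \<subseteq> Z ` {0..T} \<union> cball (Z T) r"
  proof (rule image_subsetI)
    fix t assume "t \<in> {0..T + e}"
    then show "z' t \<in> Z ` {0..T} \<union> cball (Z T) r"
      using y[of "t - T"] by (auto simp: z'_def)
  qed
  ultimately have Fz'cont: "continuous_on {0..T + e} (\<lambda>t. F (z' t))"
    using continuous_on_compose2[OF _ z'cont] by blast
  have "(z' has_vector_derivative F (z' t)) (at t)" if t: "t \<in> {0<..<T + e} - {T}" for t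
  proof (cases "t < T")
    case True
    have "(z has_vector_derivative F (z t)) (at t within {0<..<T})"
      by (rule has_vector_derivative_within_subset[OF conjunct2[OF z]]) (use t True in auto)
    then have "(z has_vector_derivative F (z t)) (at t)"
      using t True by (subst (asm) at_within_open) auto
    then have "(z' has_vector_derivative F (z t)) (at t)"
      by (rule has_vector_derivative_transform_within_open[of z _ t "{0<..<T}"])
        (use t True Z z'1 in auto)
    then show ?thesis
      using t True Z z'1 by auto
  next
    case False
    have "(y has_vector_derivative F (y (t - T))) (at (t - T) within {0<..<e})"
      by (rule has_vector_derivative_within_subset[OF conjunct2[OF y]]) (use t False in auto)
    then have "(y has_vector_derivative F (y (t - T))) (at (t - T))"
      using t False by (subst (asm) at_within_open) auto
    then have "((\<lambda>x. y (x - T)) has_vector_derivative F (y (t - T))) (at t)"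
    proof -
      have "((\<lambda>x. x - T) has_vector_derivative 1) (at t)"
        by (auto intro!: derivative_eq_intros)
      from vector_diff_chain_at[OF this] show ?thesis
        using \<open>(y has_vector_derivative F (y (t - T))) (at (t - T))\<close> by (force simp: o_def)
    qed
    then have "(z' has_vector_derivative F (y (t - T))) (at t)"
      by (rule has_vector_derivative_transform_within_open[of _ _ t "{T<..}"])
        (use t False z'2 in auto)
    then show ?thesis
      using t False z'2[of t] by auto
  qed
  then have z'deriv: "(z' has_vector_derivative F (z' t)) (at t within {0..T + e})"
    if "t \<in> {0..T + e}" for t
    using that by (intro has_vector_derivative_Icc_of_interior[where S = "{T}"] z'cont Fz'cont) auto
  show ?thesis
  proof (intro exI[of _ "T + e"] exI[of _ z'] conjI ballI)
    fix t assume t: "t \<in> {0..<T + e}"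
    then show "z' t \<in> D"
      using z'D[of t] by simp
    have "t \<in> {0..T + e}"
      using t by simp
    then show "(z' has_vector_derivative F (z' t)) (at t within {0..<T + e})"
      by (rule has_vector_derivative_within_subset[OF z'deriv]) (use t in auto)
  next
    fix t assume "t \<in> {0..<T}"
    then show "z' t = z t"
      using Z(2)[of t] z'1[of t] by simp
  qed (use e in simp)
qed

section \<open>Smooth functions of one coordinate\<close>

lemma pderivative_eqI:
  assumes "(u has_derivative D) (at x)"
  shows "pderivative i u x = D (axis i 1)"
proof -
  have "(u has_derivative D) (at (x + 0 *\<^sub>R axis i 1))"
    using assms by simp
  moreover have "((\<lambda>t. x + t *\<^sub>R axis i 1) has_derivative (\<lambda>t. t *\<^sub>R axis i 1)) (at (0::real))"
    by (auto intro!: derivative_eq_intros)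
  ultimately have "((\<lambda>t. u (x + t *\<^sub>R axis i 1)) has_derivative (\<lambda>t. D (t *\<^sub>R axis i 1))) (at 0)"
    by (rule has_derivative_compose[rotated])
  moreover have "(\<lambda>t. D (t *\<^sub>R axis i 1)) = (*) (D (axis i 1))"
    using assms by (auto simp: has_derivative_def linear_simps mult.commute)
  ultimately show ?thesis
    unfolding pderivative_def by (auto intro!: DERIV_imp_deriv simp: has_field_derivative_def)
qed

lemma pderivative_cong_open:
  assumes "open S" "x \<in> S" "\<And>y. y \<in> S \<Longrightarrow> u y = v y"
  shows "pderivative i u x = pderivative i v x"
proof -
  have "((\<lambda>t. x + t *\<^sub>R axis i 1) \<longlongrightarrow> x + 0 *\<^sub>R axis i 1) (nhds (0::real))"
    by (intro tendsto_intros filterlim_ident)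
  then have "\<forall>\<^sub>F t::real in nhds 0. x + t *\<^sub>R axis i 1 \<in> S"
    by (rule topological_tendstoD) (use assms in auto)
  then show ?thesis
    unfolding pderivative_def by (intro deriv_cong_ev) (auto elim!: eventually_mono simp: assms)
qed

lemma Ck_on_cong_open:
  assumes "open S" "\<And>y. y \<in> S \<Longrightarrow> u y = v y"
  shows "Ck_on m u S \<longleftrightarrow> Ck_on m v S"
  using assms(2)
proof (induction m arbitrary: u v)
  case 0
  then show ?case
    by (simp cong: continuous_on_cong)
next
  case (Suc m)
  have "u differentiable at x \<longleftrightarrow> v differentiable at x" if "x \<in> S" for x
    using Suc.prems that \<open>open S\<close> unfolding differentiable_def
    by (metis has_derivative_transform_within_open)
  moreover have "Ck_on m (pderivative i u) S \<longleftrightarrow> Ck_on m (pderivative i v) S" for i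
    using Suc.prems \<open>open S\<close> by (intro Suc.IH pderivative_cong_open)
  ultimately show ?case
    by simp
qed

lemma has_derivative_coord:
  fixes x :: "real ^ 'n::finite"
  assumes "(g has_real_derivative d) (at (x $ k))"
  shows "((\<lambda>x. g (x $ k)) has_derivative (\<lambda>h. d * h $ k)) (at x)"
  using has_derivative_compose[of "\<lambda>x. x $ k" "\<lambda>h. h $ k" x UNIV g "(*) d"] assms
  by (simp add: has_field_derivative_def bounded_linear_imp_has_derivative bounded_linear_vec_nth)

lemma pderivative_coord:
  fixes x :: "real ^ 'n::finite"
  assumes "(g has_real_derivative d) (at (x $ k))"
  shows "pderivative i (\<lambda>x. g (x $ k)) x = (if i = k then d else 0)"
  by (subst pderivative_eqI[OF has_derivative_coord[OF assms]]) (auto simp: axis_def)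

text \<open>
  A family of functions on \<open>S\<close> whose derivatives again lie in the algebra generated by the family
  consists of smooth functions. A solution of a differential equation and the coefficients of the
  equation form such a family, so its smoothness needs neither the smoothness of compositions nor
  that of inverse functions. Inverses are admitted where they exist on all of \<open>S\<close>.
\<close>

inductive_set function_algebra :: "(real \<Rightarrow> real) set \<Rightarrow> real set \<Rightarrow> (real \<Rightarrow> real) set"
  for \<G> S where
  gen: "g \<in> \<G> \<Longrightarrow> g \<in> function_algebra \<G> S"
| const: "(\<lambda>_. c) \<in> function_algebra \<G> S"
| add: "g \<in> function_algebra \<G> S \<Longrightarrow> h \<in> function_algebra \<G> S \<Longrightarrow>
    (\<lambda>x. g x + h x) \<in> function_algebra \<G> S"
| mult: "g \<in> function_algebra \<G> S \<Longrightarrow> h \<in> function_algebra \<G> S \<Longrightarrow>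
    (\<lambda>x. g x * h x) \<in> function_algebra \<G> S"
| inverse: "g \<in> function_algebra \<G> S \<Longrightarrow> \<forall>x\<in>S. g x \<noteq> 0 \<Longrightarrow>
    (\<lambda>x. inverse (g x)) \<in> function_algebra \<G> S"

lemma function_algebra_has_derivative:
  assumes gens: "\<And>g. g \<in> \<G> \<Longrightarrow>
      \<exists>g'\<in>function_algebra \<G> S. \<forall>x\<in>S. (g has_real_derivative g' x) (at x)"
    and "g \<in> function_algebra \<G> S"
  shows "\<exists>g'\<in>function_algebra \<G> S. \<forall>x\<in>S. (g has_real_derivative g' x) (at x)"
  using assms(2)
proof induction
  case (gen g)
  then show ?case by (rule gens)
next
  case (const c)
  show ?case
    by (intro bexI[of _ "\<lambda>_. 0"] function_algebra.const) auto
next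
  case (add g h)
  then obtain g' h' where *: "g' \<in> function_algebra \<G> S" "h' \<in> function_algebra \<G> S"
    "\<forall>x\<in>S. (g has_real_derivative g' x) (at x)" "\<forall>x\<in>S. (h has_real_derivative h' x) (at x)"
    by blast
  show ?case
    by (intro bexI[of _ "\<lambda>x. g' x + h' x"] function_algebra.add)
      (use * in \<open>auto intro!: derivative_eq_intros\<close>)
next
  case (mult g h)
  then obtain g' h' where *: "g' \<in> function_algebra \<G> S" "h' \<in> function_algebra \<G> S"
    "\<forall>x\<in>S. (g has_real_derivative g' x) (at x)" "\<forall>x\<in>S. (h has_real_derivative h' x) (at x)"
    by blast
  show ?case
    by (intro bexI[of _ "\<lambda>x. g' x * h x + h' x * g x"] function_algebra.add function_algebra.mult)
      (use * mult.hyps in \<open>auto intro!: derivative_eq_intros\<close>)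
next
  case (inverse g)
  then obtain g' where *: "g' \<in> function_algebra \<G> S"
    "\<forall>x\<in>S. (g has_real_derivative g' x) (at x)"
    by blast
  show ?case
    by (intro bexI[of _ "\<lambda>x. (- 1) * (inverse (g x) * g' x * inverse (g x))"]
        function_algebra.mult function_algebra.inverse function_algebra.const)
      (use * inverse.hyps in \<open>auto intro!: derivative_eq_intros\<close>)
qed

text \<open>
  The algebra is closed under differentiation, so induction on the order applies to all of its members
  at once. A partial derivative in a direction other than \<open>k\<close> vanishes, and \<open>0\<close> is in the algebra.
\<close>

lemma smooth_on_coord_function_algebra:
  fixes k :: "'n::finite"
  assumes gens: "\<And>g. g \<in> \<G> \<Longrightarrow>
      \<exists>g'\<in>function_algebra \<G> S. \<forall>x\<in>S. (g has_real_derivative g' x) (at x)"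
    and "open S" and "g \<in> function_algebra \<G> S"
  shows "smooth_on (\<lambda>x. g (x $ k)) {x :: real ^ 'n. x $ k \<in> S}"
proof -
  let ?U = "{x :: real ^ 'n. x $ k \<in> S}"
  have "open ?U"
    using continuous_open_vimage[of S "\<lambda>x :: real ^ 'n. x $ k"] \<open>open S\<close>
    by (auto simp: vimage_def intro!: continuous_intros)
  have "Ck_on m (\<lambda>x. g (x $ k)) ?U" if "g \<in> function_algebra \<G> S" for m g
    using that
  proof (induction m arbitrary: g)
    case (0 g)
    obtain g' where g': "\<forall>x\<in>S. (g has_real_derivative g' x) (at x)"
      using function_algebra_has_derivative[of \<G> S, OF gens 0] by blast
    have "continuous (at x) (\<lambda>x. g (x $ k))" if "x \<in> ?U" for x
    proof -
      have "(g has_real_derivative g' (x $ k)) (at (x $ k))"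
        using g' that by simp
      then show ?thesis
        by (rule has_derivative_continuous[OF has_derivative_coord])
    qed
    then show ?case
      by (simp add: continuous_at_imp_continuous_on)
  next
    case (Suc m g)
    obtain g' where g'_alg: "g' \<in> function_algebra \<G> S"
      and g': "\<forall>x\<in>S. (g has_real_derivative g' x) (at x)"
      using function_algebra_has_derivative[of \<G> S, OF gens Suc.prems] by blast
    have "(\<lambda>x. g (x $ k)) differentiable at x" if "x \<in> ?U" for x
    proof -
      have "(g has_real_derivative g' (x $ k)) (at (x $ k))"
        using g' that by simp
      then show ?thesis
        unfolding differentiable_def by (blast intro: has_derivative_coord)
    qed
    moreover have "Ck_on m (pderivative i (\<lambda>x. g (x $ k))) ?U" for i
    proof -
      have "pderivative i (\<lambda>x. g (x $ k)) x = (if i = k then g' else (\<lambda>_. 0)) (x $ k)"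
        if "x \<in> ?U" for x
      proof -
        have "(g has_real_derivative g' (x $ k)) (at (x $ k))"
          using g' that by simp
        then show ?thesis
          by (simp add: pderivative_coord)
      qed
      moreover have "Ck_on m (\<lambda>x. (if i = k then g' else (\<lambda>_. 0)) (x $ k)) ?U"
        using g'_alg by (intro Suc.IH) (auto intro: function_algebra.const)
      ultimately show ?thesis
        by (subst Ck_on_cong_open[OF \<open>open ?U\<close>])
    qed
    ultimately show ?case
      by simp
  qed
  then show ?thesis
    using assms(3) by (simp add: smooth_on_def)
qed

section \<open>Eigenvalues and the slice of the cone\<close>

text \<open>
  The roots of the characteristic polynomial determine the eigenvalues as a multiset, that is, up to
  the permutation \<open>\<sigma>\<close> left open by the choice operator.
\<close>

lemma eigenvalues_diagonal:
  fixes d :: "real ^ 'n::finite"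
  obtains \<sigma> where "bij \<sigma>" "eigenvalues (\<chi> i j. if i = j then d $ i else 0) = (\<chi> i. d $ \<sigma> i)"
proof -
  let ?M = "(\<chi> i j. if i = j then d $ i else 0) :: real ^ 'n ^ 'n"
  have det: "det (mat t - ?M) = (\<Prod>i\<in>UNIV. t - d $ i)" for t
    by (subst det_diagonal) (auto simp: mat_def)
  define l where "l = eigenvalues ?M"
  have "\<forall>t. det (mat t - ?M) = (\<Prod>i\<in>UNIV. t - l $ i)"
    unfolding l_def eigenvalues_def by (rule someI[of _ d]) (simp add: det)
  then have eq: "(\<Prod>i\<in>UNIV. t - l $ i) = (\<Prod>i\<in>UNIV. t - d $ i)" for t
    by (simp add: det)
  have "(\<Prod>i\<in>UNIV. [:- (l $ i), 1:]) = (\<Prod>i\<in>UNIV. [:- (d $ i), 1:])"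
    by (simp flip: poly_eq_poly_eq_iff add: fun_eq_iff poly_prod eq)
  then have "proots (\<Prod>i\<in>UNIV. [:- (l $ i), 1:]) = proots (\<Prod>i\<in>UNIV. [:- (d $ i), 1:])"
    by simp
  then have "(\<Sum>i\<in>UNIV. {# l $ i #}) = (\<Sum>i\<in>UNIV. {# d $ i #})"
    by (simp add: proots_prod)
  then have "image_mset (($) l) (mset_set UNIV) = image_mset (($) d) (mset_set UNIV)"
    by (simp add: sum_unfold_sum_mset)
  then obtain \<sigma> where "\<sigma> permutes UNIV" "\<forall>i\<in>UNIV. l $ i = d $ \<sigma> i"
    using image_mset_eq_implies_permutes[OF finite_class.finite_UNIV] by metis
  then show thesis
    by (intro that[of \<sigma>]) (auto simp: permutes_bij l_def vec_eq_iff)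
qed

text \<open>
  The line \<open>(s, 1, \<dots>, 1)\<close>, with \<open>s\<close> in the slot \<open>k\<close>. Up to scaling, the eigenvalues of
  \<open>- A\<^sub>w\<close> lie on it when \<open>w\<close> depends on \<open>x\<^sub>k\<close> only.
\<close>

definition slice :: "'n::finite \<Rightarrow> real \<Rightarrow> real ^ 'n" where
  "slice k s = (\<chi> i. if i = k then s else 1)"

lemma slice_eq_line: "slice k s = slice k 0 + s *\<^sub>R axis k 1"
  by (simp add: slice_def vec_eq_iff axis_def)

lemma has_derivative_slice:
  "(slice k has_derivative (\<lambda>h. h *\<^sub>R axis k 1)) (at s)"
proof -
  have "((\<lambda>s. slice k 0 + s *\<^sub>R axis k 1) has_derivative (\<lambda>h. h *\<^sub>R axis k 1)) (at s)"
    by (auto intro!: derivative_eq_intros)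
  then show ?thesis
    by (simp flip: slice_eq_line)
qed

lemma continuous_on_slice: "continuous_on S (slice k)"
  by (intro continuous_at_imp_continuous_on ballI has_derivative_continuous[OF has_derivative_slice])

lemma Ck_on_funpow_pderivative:
  "Ck_on (m + j) f S \<Longrightarrow> Ck_on j ((pderivative i ^^ m) f) S"
  by (induction m arbitrary: f) (auto simp: funpow_Suc_right simp del: funpow.simps)

lemma has_real_derivative_slice_funpow:
  assumes "smooth_on f \<Gamma>" "slice k s \<in> \<Gamma>"
  shows "((\<lambda>s. (pderivative k ^^ m) f (slice k s)) has_real_derivative
    (pderivative k ^^ Suc m) f (slice k s)) (at s)"
proof -
  let ?g = "(pderivative k ^^ m) f"
  have "Ck_on (m + Suc 0) f \<Gamma>"
    using assms(1) unfolding smooth_on_def ..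
  then have "Ck_on (Suc 0) ?g \<Gamma>"
    by (rule Ck_on_funpow_pderivative)
  then obtain D where D: "(?g has_derivative D) (at (slice k s))"
    using assms(2) by (auto simp: differentiable_def)
  have "((\<lambda>s. ?g (slice k s)) has_derivative (\<lambda>h. D (h *\<^sub>R axis k 1))) (at s)"
    using has_derivative_compose[OF has_derivative_slice D] .
  moreover have "(\<lambda>h. D (h *\<^sub>R axis k 1)) = (*) (D (axis k 1))"
    using D by (auto simp: has_derivative_def linear_simps mult.commute)
  ultimately show ?thesis
    by (simp add: has_field_derivative_def pderivative_eqI[OF D])
qed

lemma has_real_derivative_slice:
  assumes "smooth_on f \<Gamma>" "slice k s \<in> \<Gamma>"
  shows "((\<lambda>s. f (slice k s)) has_real_derivative pderivative k f (slice k s)) (at s)"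
  using has_real_derivative_slice_funpow[OF assms, of 0] by simp

section \<open>Solutions that depend on one coordinate\<close>

lemma half_space_simps:
  fixes k :: "'n::finite"
  shows open_half_space: "open (half_space k)"
    and closure_half_space: "closure (half_space k) = {x. x $ k \<ge> 0}"
    and frontier_half_space: "frontier (half_space k) = {x. x $ k = 0}"
proof -
  show 1: "open (half_space k)"
    unfolding half_space_def by (intro open_Collect_less continuous_intros)
  show 2: "closure (half_space k) = {x. x $ k \<ge> 0}"
    by (simp add: half_space_def)
  show "frontier (half_space k) = {x. x $ k = 0}"
    using interior_open[OF 1] by (auto simp: frontier_def 2) (auto simp: half_space_def)
qed

text \<open>
  The one-dimensional form of the equation, as a first-order system. Here \<open>p\<close> is the slope \<open>u'\<close> and
  \<open>s = 1 - 2 u u'' / p\<^sup>2\<close> is the exceptional eigenvalue of \<open>- A\<^sub>w\<close> divided by the common value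
  \<open>p\<^sup>2 / 2\<close> of the others. By homogeneity the equation is \<open>p\<^sup>2 f(s, 1, \<dots>, 1) = 1\<close>; the formula for
  \<open>p'\<close> is the definition of \<open>s\<close>, and the one for \<open>s'\<close> comes from differentiating the equation. The two limits say
  that \<open>u\<close> leaves the boundary value \<open>0\<close> with slope \<open>1\<close>.
\<close>

locale profile =
  fixes f :: "real ^ 'n::finite \<Rightarrow> real" and \<Gamma> :: "(real ^ 'n) set" and k :: 'n
    and u p s :: "real \<Rightarrow> real"
  assumes pair: "normalized_admissible_pair f \<Gamma>"
    and u_0: "u 0 = 0"
    and u_tendsto: "(u \<longlongrightarrow> 0) (at_right 0)"
    and p_tendsto: "(p \<longlongrightarrow> 1) (at_right 0)"
    and u_pos: "0 < x \<Longrightarrow> 0 < u x"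
    and p_ge: "0 < x \<Longrightarrow> 1 \<le> p x"
    and s_le: "0 < x \<Longrightarrow> s x \<le> 1"
    and slice_in: "0 < x \<Longrightarrow> slice k (s x) \<in> \<Gamma>"
    and f_slice: "0 < x \<Longrightarrow> (p x)\<^sup>2 * f (slice k (s x)) = 1"
    and u_deriv: "0 < x \<Longrightarrow> (u has_real_derivative p x) (at x)"
    and p_deriv: "0 < x \<Longrightarrow>
      (p has_real_derivative (p x)\<^sup>2 * (1 - s x) / (2 * u x)) (at x)"
    and s_deriv: "0 < x \<Longrightarrow> (s has_real_derivative
      - (1 - s x) / (p x * u x * pderivative k f (slice k (s x)))) (at x)"
begin

lemma f_smooth: "smooth_on f \<Gamma>"
  using pair by (simp add: normalized_admissible_pair_def)

lemma f_deriv_pos: "l \<in> \<Gamma> \<Longrightarrow> 0 < pderivative i f l"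
  using pair by (simp add: normalized_admissible_pair_def)

text \<open>
  The functions \<open>u\<close>, \<open>p\<close>, \<open>s\<close> and the derivatives \<open>H m\<close> of \<open>f\<close> along the slice, evaluated
  at \<open>s\<close>, generate an algebra closed under differentiation: the only denominators in the system are
  \<open>u\<close>, \<open>p\<close> and \<open>H 1\<close>, which is positive by ellipticity.
\<close>

lemma smooth_on_u_coord: "smooth_on (\<lambda>x. u (x $ k)) (half_space k)"
proof -
  define H where "H m x = (pderivative k ^^ m) f (slice k (s x))" for m x
  define \<G> where "\<G> = {u, p, s} \<union> range H"
  let ?A = "function_algebra \<G> {0<..}"
  have atoms: "u \<in> ?A" "p \<in> ?A" "s \<in> ?A" and H: "H m \<in> ?A" for m
    by (auto simp: \<G>_def intro!: function_algebra.gen)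
  have H1: "H (Suc 0) x = pderivative k f (slice k (s x))" for x
    by (simp add: H_def)
  have nz: "\<forall>x\<in>{0<..}. u x \<noteq> 0" "\<forall>x\<in>{0<..}. p x * u x * H (Suc 0) x \<noteq> 0"
  proof -
    have "u x \<noteq> 0" "p x \<noteq> 0" "H (Suc 0) x \<noteq> 0" if "x > 0" for x
      using u_pos[OF that] p_ge[OF that] f_deriv_pos[OF slice_in[OF that], of k]
      unfolding H1 by linarith+
    then show "\<forall>x\<in>{0<..}. u x \<noteq> 0" "\<forall>x\<in>{0<..}. p x * u x * H (Suc 0) x \<noteq> 0"
      by simp_all
  qed
  define s' where "s' x = (- 1) * ((1 + (- 1) * s x) * inverse (p x * u x * H (Suc 0) x))" for x
  have s'_alg: "s' \<in> ?A"
    unfolding s'_def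
    by (intro function_algebra.mult function_algebra.add function_algebra.inverse
        function_algebra.const atoms H nz)
  have s': "(s has_real_derivative s' x) (at x)" if "x > 0" for x
    using s_deriv[OF that] by (simp add: s'_def H1 field_simps)
  define p' where "p' x = (p x * p x * (1 + (- 1) * s x) * (1 / 2)) * inverse (u x)" for x
  have p'_alg: "p' \<in> ?A"
    unfolding p'_def
    by (intro function_algebra.mult function_algebra.add function_algebra.inverse
        function_algebra.const atoms H nz)
  have p': "(p has_real_derivative p' x) (at x)" if "x > 0" for x
    using p_deriv[OF that] by (simp add: p'_def field_simps power2_eq_square)
  have H': "(H m has_real_derivative H (Suc m) x * s' x) (at x)" if "x > 0" for m x
    unfolding H_def
    by (rule DERIV_chain2[OF has_real_derivative_slice_funpow[OF f_smooth slice_in[OF that]] s'[OF that]])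
  have gens: "\<exists>g'\<in>?A. \<forall>x\<in>{0<..}. (g has_real_derivative g' x) (at x)" if g: "g \<in> \<G>" for g
  proof -
    consider "g = u" | "g = p" | "g = s" | m where "g = H m"
      using g by (auto simp: \<G>_def)
    then show ?thesis
    proof cases
      case 1
      then show ?thesis
        by (intro bexI[of _ p]) (auto simp: u_deriv atoms)
    next
      case 2
      then show ?thesis
        by (intro bexI[of _ p']) (auto simp: p' p'_alg)
    next
      case 3
      then show ?thesis
        by (intro bexI[of _ s']) (auto simp: s' s'_alg)
    next
      case (4 m)
      then show ?thesis
        by (intro bexI[of _ "\<lambda>x. H (Suc m) x * s' x"] function_algebra.mult H s'_alg)
          (auto simp: H')
    qed
  qed
  show ?thesis
    using smooth_on_coord_function_algebra[OF gens, of u k] atoms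
    by (simp add: half_space_def)
qed

lemma neg_schouten_coord:
  assumes "x \<in> half_space k"
  shows "- schouten (\<lambda>x. u (x $ k)) x =
    (\<chi> i j. if i = j then (((p (x $ k))\<^sup>2 / 2) *\<^sub>R slice k (s (x $ k))) $ i else 0)"
proof -
  let ?w = "\<lambda>x :: real ^ 'n. u (x $ k)"
  let ?p' = "(p (x $ k))\<^sup>2 * (1 - s (x $ k)) / (2 * u (x $ k))"
  have pos: "y $ k > 0" if "y \<in> half_space k" for y :: "real ^ 'n"
    using that by (simp add: half_space_def)
  have d1: "pderivative j ?w y = (if j = k then p (y $ k) else 0)" if "y \<in> half_space k" for y j
    by (rule pderivative_coord[OF u_deriv[OF pos[OF that]]])
  have d2: "pderivative i (pderivative j ?w) x = (if i = k \<and> j = k then ?p' else 0)" for i j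
  proof -
    have "pderivative i (pderivative j ?w) x
        = pderivative i (\<lambda>y. (if j = k then p else (\<lambda>_. 0)) (y $ k)) x"
      by (rule pderivative_cong_open[OF open_half_space assms]) (simp add: d1)
    also have "\<dots> = (if i = k then if j = k then ?p' else 0 else 0)"
      by (rule pderivative_coord) (use p_deriv[OF pos[OF assms]] in auto)
    finally show ?thesis
      by simp
  qed
  have grad: "grad ?w x = p (x $ k) *\<^sub>R axis k 1"
    using assms by (auto simp: grad_def d1 axis_def vec_eq_iff)
  have "u (x $ k) \<noteq> 0"
    using u_pos[OF pos[OF assms]] by simp
  then show ?thesis
    by (auto simp: schouten_def grad hessian_def d2 vec_eq_iff mat_def slice_def
        norm_axis_1 field_simps)
qed

theorem smooth_positive_solution: "smooth_positive_solution f \<Gamma> k (\<lambda>x. u (x $ k))"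
  unfolding smooth_positive_solution_def
proof (intro conjI ballI)
  show "smooth_on (\<lambda>x. u (x $ k)) (half_space k)"
    by (rule smooth_on_u_coord)
  show "continuous_on (closure (half_space k)) (\<lambda>x. u (x $ k))"
  proof -
    have "continuous_on {0..} u"
      unfolding continuous_on_eq_continuous_within
    proof
      fix x :: real assume "x \<in> {0..}"
      then consider "x = 0" | "x > 0"
        by force
      then show "continuous (at x within {0..}) u"
      proof cases
        case 1
        then show ?thesis
          using u_tendsto by (simp add: continuous_within u_0 at_within_Ici_at_right)
      next
        case 2
        then show ?thesis
          using DERIV_isCont[OF u_deriv] continuous_at_imp_continuous_at_within by blast
      qed
    qed
    then show ?thesis
      unfolding closure_half_space
      by (rule continuous_on_compose2) (auto intro!: continuous_intros)
  qed
next
  fix x assume "x \<in> frontier (half_space k)"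
  then show "u (x $ k) = 0"
    by (simp add: frontier_half_space u_0)
next
  fix x assume x: "x \<in> half_space k"
  then have pos: "x $ k > 0"
    by (simp add: half_space_def)
  show "u (x $ k) > 0"
    by (rule u_pos[OF pos])
  define c where "c = (p (x $ k))\<^sup>2 / 2"
  define d where "d = c *\<^sub>R slice k (s (x $ k))"
  have c: "c > 0"
    using p_ge[OF pos] by (simp add: c_def)
  have "admissible_cone \<Gamma>"
    using pair by (simp add: normalized_admissible_pair_def)
  then have cone: "c *\<^sub>R l \<in> \<Gamma>" "bij \<sigma> \<Longrightarrow> (\<chi> i. l $ \<sigma> i) \<in> \<Gamma>" if "l \<in> \<Gamma>" for l \<sigma>
    using c that by (auto simp: admissible_cone_def)
  have f: "f (c *\<^sub>R l) = c * f l" "bij \<sigma> \<Longrightarrow> f (\<chi> i. l $ \<sigma> i) = f l" if "l \<in> \<Gamma>" for l \<sigma>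
    using pair c that closure_subset[of \<Gamma>] by (auto simp: normalized_admissible_pair_def)
  have d: "d \<in> \<Gamma>"
    using cone(1)[OF slice_in[OF pos]] by (simp add: d_def)
  have fd: "f d = 1 / 2"
    using f(1)[OF slice_in[OF pos]] f_slice[OF pos] by (simp add: d_def c_def)
  have M: "- schouten (\<lambda>x. u (x $ k)) x = (\<chi> i j. if i = j then d $ i else 0)"
    using neg_schouten_coord[OF x] unfolding d_def c_def .
  obtain \<sigma> where \<sigma>: "bij \<sigma>"
    "eigenvalues (- schouten (\<lambda>x. u (x $ k)) x) = (\<chi> i. d $ \<sigma> i)"
    unfolding M by (rule eigenvalues_diagonal)
  show "eigenvalues (- schouten (\<lambda>x. u (x $ k)) x) \<in> \<Gamma>"
    using cone(2)[OF d \<sigma>(1)] by (simp add: \<sigma>)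
  show "f (eigenvalues (- schouten (\<lambda>x. u (x $ k)) x)) = 1 / 2"
    using f(2)[OF d \<sigma>(1)] by (simp add: \<sigma> fd)
qed

text \<open>
  The similarity \<open>x \<mapsto> r x\<close> of the half-space scales \<open>u\<close> and leaves slopes and ratios of
  eigenvalues unchanged. This symmetry produces all solutions of the family
  with \<open>a > 0\<close> from a single one.
\<close>

lemma profile_scale:
  assumes r: "r > 0"
  shows "profile f \<Gamma> k (\<lambda>x. u (r * x) / r) (\<lambda>x. p (r * x)) (\<lambda>x. s (r * x))"
proof
  have lim: "filterlim (\<lambda>x. r * x) (at_right 0) (at_right 0)"
  proof -
    have "((\<lambda>x. r * x) \<longlongrightarrow> r * 0) (at_right 0)"
      by (intro tendsto_intros)
    moreover have "\<forall>\<^sub>F x in at_right 0. r * x \<in> {0<..} \<and> r * x \<noteq> 0"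
      using r by (auto simp: eventually_at_filter)
    ultimately show ?thesis
      by (simp add: filterlim_at)
  qed
  show "((\<lambda>x. u (r * x) / r) \<longlongrightarrow> 0) (at_right 0)"
    using tendsto_divide[OF filterlim_compose[OF u_tendsto lim] tendsto_const[of r]] r by simp
  show "((\<lambda>x. p (r * x)) \<longlongrightarrow> 1) (at_right 0)"
    by (rule filterlim_compose[OF p_tendsto lim])
  fix x :: real assume "x > 0"
  then have x: "r * x > 0"
    using r by simp
  have lin: "((\<lambda>x. r * x) has_real_derivative r) (at x)"
    by (auto intro!: derivative_eq_intros)
  show "((\<lambda>x. u (r * x) / r) has_real_derivative p (r * x)) (at x)"
    using DERIV_cdivide[OF DERIV_chain2[OF u_deriv[OF x] lin], of r] r by simp
  show "((\<lambda>x. p (r * x)) has_real_derivative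
      (p (r * x))\<^sup>2 * (1 - s (r * x)) / (2 * (u (r * x) / r))) (at x)"
    using DERIV_chain2[OF p_deriv[OF x] lin] r by (simp add: field_simps)
  show "((\<lambda>x. s (r * x)) has_real_derivative - (1 - s (r * x)) /
      (p (r * x) * (u (r * x) / r) * pderivative k f (slice k (s (r * x))))) (at x)"
    using DERIV_chain2[OF s_deriv[OF x] lin] r by (simp add: field_simps)
  show "0 < u (r * x) / r" "1 \<le> p (r * x)" "s (r * x) \<le> 1" "slice k (s (r * x)) \<in> \<Gamma>"
    "(p (r * x))\<^sup>2 * f (slice k (s (r * x))) = 1"
    using x r u_pos p_ge s_le slice_in f_slice by auto
qed (use u_0 pair in auto)

end

lemma slice_1: "slice k 1 = (\<chi> i. 1)"
  by (simp add: slice_def)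

lemma slice_in_cone:
  assumes "admissible_cone \<Gamma>" "s > 0"
  shows "slice k s \<in> \<Gamma>"
proof -
  have "slice k s \<in> Gamma_n"
    using assms(2) by (simp add: slice_def Gamma_n_def)
  then show ?thesis
    using assms(1) by (auto simp: admissible_cone_def)
qed

text \<open>
  The hyperbolic metric.
\<close>

lemma profile_id:
  assumes "normalized_admissible_pair f \<Gamma>"
  shows "profile f \<Gamma> k (\<lambda>x. x) (\<lambda>_. 1) (\<lambda>_. 1)"
proof -
  have "f (slice k 1) = 1" "slice k 1 \<in> \<Gamma>"
    using assms slice_in_cone[of \<Gamma> 1 k]
    by (auto simp: normalized_admissible_pair_def slice_1)
  then show ?thesis
    by unfold_locales (use assms in \<open>auto intro!: derivative_eq_intros tendsto_intros\<close>)
qed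

section \<open>The invariant mu of the cone\<close>

lemma slice_in_cone_iff_any_slot:
  assumes "admissible_cone \<Gamma>"
  shows "slice i s \<in> \<Gamma> \<longleftrightarrow> slice j s \<in> \<Gamma>"
proof -
  have "slice j s \<in> \<Gamma>" if "slice i s \<in> \<Gamma>" for i j
  proof -
    have "(\<chi> l. slice i s $ Transposition.transpose i j l) = slice j s"
      by (auto simp: slice_def vec_eq_iff Transposition.transpose_def)
    moreover have "bij (Transposition.transpose i j)"
      by simp
    ultimately show ?thesis
      using assms that unfolding admissible_cone_def by (auto dest!: spec[of _ "Transposition.transpose i j"])
  qed
  then show ?thesis
    by blast
qed

lemma slice_convex_combination:
  "a + b = 1 \<Longrightarrow> slice k (a * s + b * t) = a *\<^sub>R slice k s + b *\<^sub>R slice k t"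
  by (auto simp: slice_def vec_eq_iff)

text \<open>
  The parameters of the slice that lie in the cone form an open interval. It contains all positive
  numbers since \<open>\<Gamma>\<^sub>n\<^sup>+ \<subseteq> \<Gamma>\<close>, and it is bounded below since the coordinate sum is positive on \<open>\<Gamma>\<close>.
\<close>

lemma slice_ray:
  fixes \<Gamma> :: "(real ^ 'n::finite) set"
  assumes cone: "admissible_cone \<Gamma>"
  obtains m where "\<And>i s. slice i s \<in> \<Gamma> \<longleftrightarrow> m < s" "\<And>i. slice i m \<in> frontier \<Gamma>"
    "1 - real CARD('n) \<le> m" "m \<le> 0"
proof -
  obtain k :: 'n where True by simp
  define S where "S = {s. slice k s \<in> \<Gamma>}"
  have \<Gamma>: "open \<Gamma>" "convex \<Gamma>" "\<Gamma> \<subseteq> Gamma_1"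
    using cone by (auto simp: admissible_cone_def)
  have pos: "s \<in> S" if "s > 0" for s
    using slice_in_cone[OF cone that] by (simp add: S_def)
  have "open S"
    using continuous_open_vimage[OF \<Gamma>(1), of "slice k"] continuous_on_slice[of UNIV k]
    by (simp add: S_def vimage_def continuous_on_eq_continuous_at)
  have "convex S"
    using \<open>convex \<Gamma>\<close> by (auto simp: S_def convex_def slice_convex_combination)
  have lower: "1 - real CARD('n) \<le> s" if "s \<in> S" for s
  proof -
    have "real (card (- {k})) = real CARD('n) - 1"
      by (simp add: Compl_eq_Diff_UNIV card_Diff_singleton of_nat_diff Suc_leI)
    then have "(\<Sum>i\<in>UNIV. slice k s $ i) = s + (real CARD('n) - 1)"
      by (simp add: slice_def sum.If_cases)
    then show ?thesis
      using that \<Gamma>(3) by (auto simp: S_def Gamma_1_def)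
  qed
  then have bdd: "bdd_below S"
    unfolding bdd_below_def by blast
  define m where "m = Inf S"
  have "S \<noteq> {}"
    using pos[of 1] by auto
  have m_le: "m \<le> s" if "s \<in> S" for s
    unfolding m_def using that bdd by (rule cInf_lower)
  have "m \<notin> S"
  proof
    assume "m \<in> S"
    then obtain e where "e > 0" "ball m e \<subseteq> S"
      using \<open>open S\<close> open_contains_ball by blast
    then have "m - e / 2 \<in> S"
      by (auto simp: dist_real_def subset_iff)
    then show False
      using m_le[of "m - e / 2"] \<open>e > 0\<close> by simp
  qed
  have S_eq: "s \<in> S \<longleftrightarrow> m < s" for s
  proof
    assume "s \<in> S"
    then show "m < s"
      using m_le[of s] \<open>m \<notin> S\<close> by (cases "m = s") auto
  next
    assume "m < s"
    then obtain a where a: "a \<in> S" "a < s"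
      using cInf_lessD[OF \<open>S \<noteq> {}\<close>] unfolding m_def by blast
    have "max s 0 + 1 \<in> S"
      by (rule pos) simp
    moreover have "is_interval S"
      using \<open>convex S\<close> by (simp add: is_interval_convex_1)
    ultimately show "s \<in> S"
      using a mem_is_interval_1_I[of S a "max s 0 + 1" s] by simp
  qed
  have iff: "slice i s \<in> \<Gamma> \<longleftrightarrow> m < s" for i s
    using S_eq[of s] slice_in_cone_iff_any_slot[OF cone, of i s k] by (simp add: S_def)
  have "slice i m \<in> frontier \<Gamma>" for i
  proof -
    have "slice i ` closure {m<..} \<subseteq> closure \<Gamma>"
      by (rule image_closure_subset[OF continuous_on_slice])
        (use iff closure_subset[of \<Gamma>] in auto)
    then have "slice i m \<in> closure \<Gamma>"
      by auto
    then show ?thesis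
      using iff[of i m] \<Gamma>(1) by (simp add: frontier_def interior_open)
  qed
  moreover have "m \<le> 0"
    using S_eq[of "m / 2"] pos[of "m / 2"] S_eq[of m] pos[of m] by linarith
  moreover have "1 - real CARD('n) \<le> m"
    unfolding m_def by (rule cInf_greatest[OF \<open>S \<noteq> {}\<close>]) (rule lower)
  ultimately show thesis
    using that[of m] iff by blast
qed

text \<open>
  This is what the definite description in \<open>mu_plus\<close> denotes. For uniqueness: the open segment
  between an interior point and a point of the closure of a convex set lies in the interior, so of
  two frontier points on the slice the upper one would be interior.
\<close>

lemma mu_plus_slice:
  fixes \<Gamma> :: "(real ^ 'n::finite) set"
  assumes cone: "admissible_cone \<Gamma>"
  shows "slice i s \<in> \<Gamma> \<longleftrightarrow> - mu_plus \<Gamma> < s" and "slice i (- mu_plus \<Gamma>) \<in> frontier \<Gamma>"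
    and "0 \<le> mu_plus \<Gamma>"
proof -
  obtain m where iff: "\<And>i s. slice i s \<in> \<Gamma> \<longleftrightarrow> m < s" and front: "\<And>i. slice i m \<in> frontier \<Gamma>"
    and m: "1 - real CARD('n) \<le> m" "m \<le> 0"
    using slice_ray[OF cone] by metis
  have \<Gamma>: "open \<Gamma>" "convex \<Gamma>"
    using cone by (auto simp: admissible_cone_def)
  have "mu_plus \<Gamma> = - m"
    unfolding mu_plus_def slice_def[symmetric]
  proof (rule the_equality)
    show "- m \<in> {0..real CARD('n) - 1} \<and> (\<forall>i. slice i (- (- m)) \<in> frontier \<Gamma>)"
      using m front by auto
  next
    fix \<mu> assume "\<mu> \<in> {0..real CARD('n) - 1} \<and> (\<forall>i. slice i (- \<mu>) \<in> frontier \<Gamma>)"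
    then have \<mu>: "slice i (- \<mu>) \<in> frontier \<Gamma>" for i
      by simp
    obtain k :: 'n where True by simp
    have "slice k (- \<mu>) \<notin> \<Gamma>"
      using \<mu>[of k] \<Gamma>(1) by (simp add: frontier_def interior_open)
    then have "- \<mu> \<le> m"
      by (simp add: iff)
    moreover have "\<not> - \<mu> < m"
    proof
      assume "- \<mu> < m"
      have "open_segment (slice k (m + 1)) (slice k (- \<mu>)) \<subseteq> interior \<Gamma>"
        using \<mu>[of k] \<Gamma> by (intro in_interior_closure_convex_segment)
          (auto simp: interior_open iff frontier_def)
      moreover have "slice k m \<in> open_segment (slice k (m + 1)) (slice k (- \<mu>))"
      proof -
        define c where "c = 1 / (m + 1 + \<mu>)"
        have c: "0 < c" "c < 1"
          using \<open>- \<mu> < m\<close> by (auto simp: c_def)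
        have "c * (m + 1 + \<mu>) = 1"
          using \<open>- \<mu> < m\<close> by (simp add: c_def)
        then have "m = (1 - c) * (m + 1) + c * (- \<mu>)"
          by (simp add: algebra_simps)
        then have "slice k m = (1 - c) *\<^sub>R slice k (m + 1) + c *\<^sub>R slice k (- \<mu>)"
          using slice_convex_combination[of "1 - c" c k "m + 1" "- \<mu>"] by simp
        moreover have "slice k (m + 1) \<noteq> slice k (- \<mu>)"
          using iff[of k "m + 1"] \<open>slice k (- \<mu>) \<notin> \<Gamma>\<close> by auto
        ultimately show ?thesis
          using c by (auto simp: in_segment)
      qed
      ultimately show False
        using iff[of k m] interior_subset[of \<Gamma>] by auto
    qed
    ultimately show "\<mu> = - m"
      by simp
  qed
  then show "slice i s \<in> \<Gamma> \<longleftrightarrow> - mu_plus \<Gamma> < s" "slice i (- mu_plus \<Gamma>) \<in> frontier \<Gamma>"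
    "0 \<le> mu_plus \<Gamma>"
    using iff front m by auto
qed

section \<open>Solving the one-dimensional equation by quadrature\<close>

lemma DERIV_inv_into:
  fixes f :: "real \<Rightarrow> real"
  assumes "open S" and deriv: "\<And>x. x \<in> S \<Longrightarrow> (f has_real_derivative f' x) (at x)"
    and nz: "\<And>x. x \<in> S \<Longrightarrow> f' x \<noteq> 0" and inj: "inj_on f S" and y: "y \<in> f ` S"
  shows "(inv_into S f has_real_derivative inverse (f' (inv_into S f y))) (at y)"
proof -
  let ?x = "inv_into S f y"
  have x: "?x \<in> S" "f ?x = y"
    using y by (auto simp: inv_into_into f_inv_into_f)
  have "continuous_on S f"
    using deriv by (intro continuous_at_imp_continuous_on) (auto intro: DERIV_isCont)
  then show ?thesis
    unfolding has_field_derivative_def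
  proof (rule has_derivative_inverse_strong_x[where f = f and g = "inv_into S f" and S = S and y = y,
        OF \<open>open S\<close> x(1)])
    show "(f has_derivative (*) (f' ?x)) (at ?x)"
      using deriv[OF x(1)] by (simp add: has_field_derivative_def)
    show "(*) (f' ?x) \<circ> (*) (inverse (f' ?x)) = id"
      using nz[OF x(1)] by (auto simp: fun_eq_iff)
  qed (use inj x in auto)
qed

lemma antiderivative_on_open_interval:
  fixes g :: "real \<Rightarrow> real"
  assumes "a < b" "\<And>x. x \<in> {a<..<b} \<Longrightarrow> isCont g x"
  obtains G where "\<And>x. x \<in> {a<..<b} \<Longrightarrow> (G has_real_derivative g x) (at x)"
  using einterval_antiderivative[of "ereal a" "ereal b" g] assms
  by (auto simp: has_real_derivative_iff_has_vector_derivative)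

lemma nonincreasing_on_Ioo:
  fixes g :: "real \<Rightarrow> real"
  assumes "\<And>x. x \<in> {a<..<b} \<Longrightarrow> (g has_real_derivative g' x) (at x)"
    and "\<And>x. x \<in> {a<..<b} \<Longrightarrow> g' x \<le> 0"
    and "a < x" "x \<le> y" "y < b"
  shows "g y \<le> g x"
  using assms by (intro DERIV_nonpos_imp_nonincreasing[of x y g]) fastforce+

lemma decreasing_on_Ioo:
  fixes g :: "real \<Rightarrow> real"
  assumes "\<And>x. x \<in> {a<..<b} \<Longrightarrow> (g has_real_derivative g' x) (at x)"
    and "\<And>x. x \<in> {a<..<b} \<Longrightarrow> g' x < 0"
    and "a < x" "x < y" "y < b"
  shows "g y < g x"
  using assms by (intro DERIV_neg_imp_decreasing[of x y g]) fastforce+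

text \<open>
  With \<open>p = 1 / sqrt (h s)\<close> the system for \<open>(u, s)\<close> is separable: as functions of \<open>s\<close>,
  \<open>du / u = - h' / (h (1 - s)) ds\<close> and \<open>dx = sqrt h du\<close>. So \<open>L = ln u\<close> and the height \<open>\<xi> = x\<close> are
  antiderivatives on \<open>I = {m<..<1}\<close>, both decreasing in \<open>s\<close>, and \<open>s(x)\<close> is the inverse of \<open>\<xi>\<close>. What has to
  be shown is that \<open>\<xi>\<close> maps \<open>I\<close> onto \<open>{0<..}\<close> and that \<open>u\<close> vanishes at the end \<open>s = 1\<close>.

  At \<open>s = 1\<close>: since \<open>h'(1) > 0\<close>, the integrand of \<open>L\<close> has a pole there, so \<open>L\<close> tends to \<open>- \<infinity>\<close>;
  and \<open>dx \<le> du\<close> keeps \<open>\<xi>\<close> finite.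
  At \<open>s = m\<close>: here \<open>1 - s \<le> 2\<close>, because \<open>m \<ge> - 1\<close>. This makes \<open>u sqrt h = u / p\<close> nonincreasing in \<open>s\<close>, so the slope is
  at most a multiple of \<open>u\<close>. Such a function needs infinite height to become infinite.
\<close>

lemma slope_equation_by_quadrature:
  fixes h H :: "real \<Rightarrow> real" and m :: real
  assumes m: "- 1 \<le> m" "m \<le> 0"
    and hcont: "continuous_on {m..} h" and hm: "h m = 0" and h1: "h 1 = 1"
    and hpos: "\<And>s. m < s \<Longrightarrow> 0 < h s" and Hpos: "\<And>s. m < s \<Longrightarrow> 0 < H s"
    and Hcont: "\<And>s. m < s \<Longrightarrow> isCont H s"
    and h': "\<And>s. m < s \<Longrightarrow> (h has_real_derivative H s) (at s)"
  obtains u s where "\<And>x. 0 < x \<Longrightarrow> 0 < u x" "\<And>x. 0 < x \<Longrightarrow> s x \<in> {m<..<1}"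
    "\<And>x. 0 < x \<Longrightarrow> (u has_real_derivative 1 / sqrt (h (s x))) (at x)"
    "\<And>x. 0 < x \<Longrightarrow>
      (s has_real_derivative - (sqrt (h (s x)) * (1 - s x)) / (u x * H (s x))) (at x)"
    "(u \<longlongrightarrow> 0) (at_right 0)" "(s \<longlongrightarrow> 1) (at_right 0)"
    "\<And>t. t \<in> {m<..<1} \<Longrightarrow> \<exists>x0>0. \<forall>x\<ge>x0. s x < t"
proof -
  have h_less: "h s < h t" if "m < s" "s < t" for s t
    using DERIV_pos_imp_increasing[of s t h] that h' Hpos by (meson less_le_trans)
  define I where "I = {m<..<1}"
  have I: "s \<in> I \<longleftrightarrow> m < s \<and> s < 1" for s
    by (simp add: I_def)
  have h_lt1: "h s < 1" if "s \<in> I" for s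
    using h_less[of s 1] that by (simp add: I h1)

  obtain L where L': "\<And>s. s \<in> I \<Longrightarrow> (L has_real_derivative - H s / (h s * (1 - s))) (at s)"
  proof (rule antiderivative_on_open_interval[of m 1 "\<lambda>s. - H s / (h s * (1 - s))"])
    fix s assume "s \<in> {m<..<1}"
    then show "isCont (\<lambda>s. - H s / (h s * (1 - s))) s"
      using hpos[of s] DERIV_isCont[OF h'[of s]] by (auto intro!: continuous_intros Hcont)
  qed (use m in \<open>auto simp: I_def\<close>)
  \<comment> \<open>The function \<open>u\<close>, parametrised by \<open>s\<close>.\<close>
  define w where "w = (\<lambda>s. exp (L s))"
  have w_pos: "w s > 0" for s
    by (simp add: w_def)
  have w': "(w has_real_derivative - w s * H s / (h s * (1 - s))) (at s)" if "s \<in> I" for s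
    unfolding w_def by (auto intro!: derivative_eq_intros L'[OF that])
  have w_less: "w t < w s" if "s \<in> I" "s < t" "t \<in> I" for s t
  proof (rule decreasing_on_Ioo[of m 1 w "\<lambda>s. - w s * H s / (h s * (1 - s))"])
    fix r assume "r \<in> {m<..<1}"
    then have r: "r \<in> I" "m < r" "r < 1"
      by (auto simp: I)
    show "(w has_real_derivative - w r * H r / (h r * (1 - r))) (at r)"
      by (rule w'[OF r(1)])
    have "w r * H r / (h r * (1 - r)) > 0"
      using w_pos Hpos[OF r(2)] hpos[OF r(2)] r(3) by simp
    then show "- w r * H r / (h r * (1 - r)) < 0"
      by simp
  qed (use that in \<open>auto simp: I\<close>)

  obtain \<eta> where \<eta>: "\<eta> > 0" "\<And>s. s \<in> {1 / 2..1} \<Longrightarrow> \<eta> \<le> H s"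
  proof -
    have "\<exists>x\<in>{1 / 2..1}. \<forall>y\<in>{1 / 2..1}. H x \<le> H y"
      using m by (intro continuous_attains_inf continuous_at_imp_continuous_on ballI Hcont) auto
    then obtain t where t: "t \<in> {1 / 2..1}" "\<And>s. s \<in> {1 / 2..1} \<Longrightarrow> H t \<le> H s"
      by auto
    then have "H t > 0"
      using m by (intro Hpos) auto
    then show ?thesis
      using that[of "H t"] t(2) by blast
  qed
  \<comment> \<open>The pole of the integrand at \<open>1\<close> is compared with that of \<open>\<eta> / (1 - s)\<close>.\<close>
  have L_le: "L s \<le> L (1 / 2) + \<eta> * (ln (1 - s) - ln (1 / 2))" if "1 / 2 \<le> s" "s < 1" for s
  proof -
    let ?D = "\<lambda>s. - H s / (h s * (1 - s)) + \<eta> / (1 - s)"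
    have "L s - \<eta> * ln (1 - s) \<le> L (1 / 2) - \<eta> * ln (1 - 1 / 2)"
    proof (rule DERIV_nonpos_imp_nonincreasing[OF that(1)])
      fix t assume t: "1 / 2 \<le> t" "t \<le> s"
      then have tI: "t \<in> I"
        using that m by (simp add: I)
      have "h t * \<eta> \<le> 1 * H t"
        using h_lt1[OF tI] hpos[of t] \<eta>(1) \<eta>(2)[of t] t that m by (intro mult_mono) auto
      then have "\<eta> \<le> H t / h t"
        using hpos[of t] tI by (simp add: I pos_le_divide_eq mult.commute)
      then have "\<eta> / (1 - t) \<le> H t / h t / (1 - t)"
        using tI by (intro divide_right_mono) (auto simp: I)
      then have "?D t \<le> 0"
        by simp
      moreover have "((\<lambda>s. L s - \<eta> * ln (1 - s)) has_real_derivative ?D t) (at t)"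
        using t that by (auto intro!: derivative_eq_intros L'[OF tI])
      ultimately show "\<exists>y. ((\<lambda>s. L s - \<eta> * ln (1 - s)) has_real_derivative y) (at t) \<and> y \<le> 0"
        by blast
    qed
    then show ?thesis
      by (simp add: algebra_simps)
  qed
  have w_small: "\<exists>s\<in>I. w s < \<epsilon>" if "\<epsilon> > 0" for \<epsilon>
  proof -
    define N where "N = max 1 ((L (1 / 2) - \<eta> * ln (1 / 2) - ln \<epsilon>) / \<eta> + 1)"
    define s where "s = 1 - exp (- N)"
    have "N \<ge> 1"
      by (simp add: N_def)
    then have "exp N \<ge> 2"
      using exp_ge_add_one_self[of N] by linarith
    then have s: "1 / 2 \<le> s" "s < 1"
      by (auto simp: s_def exp_minus field_simps)
    have "(L (1 / 2) - \<eta> * ln (1 / 2) - ln \<epsilon>) / \<eta> < N"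
      by (simp add: N_def)
    then have "L (1 / 2) - \<eta> * ln (1 / 2) - ln \<epsilon> < \<eta> * N"
      using \<eta>(1) by (simp add: field_simps)
    moreover have "ln (1 - s) = - N"
      by (simp add: s_def)
    ultimately have "L s < ln \<epsilon>"
      using L_le[OF s] by (simp add: algebra_simps)
    then have "w s < \<epsilon>"
      using exp_less_mono[of "L s" "ln \<epsilon>"] that by (simp add: w_def)
    then show ?thesis
      using s m by (intro bexI[of _ s]) (auto simp: I)
  qed

  define c0 where "c0 = L (1 / 2) + ln (h (1 / 2)) / 2"
  \<comment> \<open>The inequality \<open>1 / 2 \<le> 1 / (1 - s)\<close> is where \<open>m \<ge> - 1\<close> enters.\<close>
  have L_ge: "c0 \<le> L s + ln (h s) / 2" if "m < s" "s \<le> 1 / 2" for s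
    unfolding c0_def
  proof (rule nonincreasing_on_Ioo[of m 1 "\<lambda>s. L s + ln (h s) / 2"])
    fix t assume "t \<in> {m<..<1}"
    then have t: "t \<in> I" "m < t" "t < 1"
      by (auto simp: I)
    show "((\<lambda>s. L s + ln (h s) / 2) has_real_derivative
        - H t / (h t * (1 - t)) + H t / h t / 2) (at t)"
      using hpos[OF t(2)] by (auto intro!: derivative_eq_intros L' h' t)
    have "H t / h t * (1 / 2 - 1 / (1 - t)) \<le> 0"
      using hpos[OF t(2)] Hpos[OF t(2)] t m by (intro mult_nonneg_nonpos) (auto simp: field_simps)
    then show "- H t / (h t * (1 - t)) + H t / h t / 2 \<le> 0"
      by (simp add: algebra_simps)
  qed (use that in auto)
  have w_sqrt_ge: "exp c0 \<le> w s * sqrt (h s)" if "m < s" "s \<le> 1 / 2" for s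
  proof -
    have "ln (sqrt (h s)) = ln (h s) / 2"
      using hpos[OF that(1)] by (simp add: ln_sqrt)
    moreover have "sqrt (h s) = exp (ln (sqrt (h s)))"
      using hpos[OF that(1)] by simp
    ultimately have "sqrt (h s) = exp (ln (h s) / 2)"
      by metis
    then show ?thesis
      using L_ge[OF that] by (simp add: w_def flip: exp_add)
  qed
  have h_small: "\<exists>s\<in>I. s \<le> 1 / 2 \<and> h s < \<epsilon>" if "\<epsilon> > 0" for \<epsilon>
  proof -
    have "(h \<longlongrightarrow> 0) (at m within {m..})"
      using hcont hm by (force simp: continuous_on_def)
    then have "\<forall>\<^sub>F s in at_right m. h s < \<epsilon>"
      using that by (auto simp: at_within_Ici_at_right intro: order_tendstoD)
    moreover have "\<forall>\<^sub>F s in at_right m. s \<in> {m<..<1 / 2}"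
      using m by (intro eventually_at_right_real) auto
    ultimately have "\<forall>\<^sub>F s in at_right m. h s < \<epsilon> \<and> s \<in> {m<..<1 / 2}"
      by (rule eventually_conj)
    from eventually_happens'[OF trivial_limit_at_right_real this]
    obtain s where "h s < \<epsilon> \<and> s \<in> {m<..<1 / 2}"
      by blast
    then show ?thesis
      by (intro bexI[of _ s]) (auto simp: I)
  qed
  have L_large: "\<exists>s\<in>I. s \<le> 1 / 2 \<and> B < L s" for B
  proof -
    obtain s where s: "s \<in> I" "s \<le> 1 / 2" "h s < exp (2 * (c0 - B))"
      using h_small[of "exp (2 * (c0 - B))"] by auto
    have "ln (h s) < ln (exp (2 * (c0 - B)))"
      using hpos[of s] s by (subst ln_less_cancel_iff) (auto simp: I)
    then have "ln (h s) < 2 * (c0 - B)"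
      by simp
    then show ?thesis
      using L_ge[of s] s by (intro bexI[of _ s]) (auto simp: I)
  qed

  define D where "D = (\<lambda>s. - w s * H s / (sqrt (h s) * (1 - s)))"
  obtain \<Xi> where \<Xi>': "\<And>s. s \<in> I \<Longrightarrow> (\<Xi> has_real_derivative D s) (at s)"
  proof (rule antiderivative_on_open_interval[of m 1 D])
    fix s assume "s \<in> {m<..<1}"
    then show "isCont D s"
      using hpos[of s] DERIV_isCont[OF h'[of s]] DERIV_isCont[OF w'[of s]]
      unfolding D_def by (auto intro!: continuous_intros Hcont simp: I)
  qed (use m in \<open>auto simp: I_def\<close>)
  have D_eq: "D s = - H s / (h s * (1 - s)) * (w s * sqrt (h s))" if "s \<in> I" for s
  proof -
    have "sqrt (h s) \<noteq> 0" "1 - s \<noteq> 0"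
      using hpos[of s] that by (auto simp: I)
    then have "w s * H s / (sqrt (h s) * (1 - s)) =
        H s / (sqrt (h s) * sqrt (h s) * (1 - s)) * (w s * sqrt (h s))"
      by (simp add: divide_simps)
    moreover have "sqrt (h s) * sqrt (h s) = h s"
      using hpos[of s] that by (simp add: I)
    ultimately show ?thesis
      by (simp add: D_def)
  qed
  have D_neg: "D s < 0" if "s \<in> I" for s
    using that hpos[of s] Hpos[of s] w_pos[of s] by (simp add: D_def I field_simps)
  have \<Xi>_less: "\<Xi> t < \<Xi> s" if "s \<in> I" "s < t" "t \<in> I" for s t
    using that by (intro decreasing_on_Ioo[of m 1 \<Xi> D]) (auto intro!: \<Xi>' D_neg simp: I)
  \<comment> \<open>This is \<open>dx \<le> du\<close>; it holds because the slope is at least \<open>1\<close>.\<close>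
  have w_\<Xi>: "w t - \<Xi> t \<le> w s - \<Xi> s" if "s \<in> I" "s \<le> t" "t \<in> I" for s t
  proof (rule nonincreasing_on_Ioo[of m 1 "\<lambda>s. w s - \<Xi> s"])
    fix r assume "r \<in> {m<..<1}"
    then have r: "r \<in> I" "m < r" "r < 1"
      by (auto simp: I)
    show "((\<lambda>s. w s - \<Xi> s) has_real_derivative - w r * H r / (h r * (1 - r)) - D r) (at r)"
      by (intro DERIV_diff w' \<Xi>' r)
    define A where "A = - w r * H r / (h r * (1 - r))"
    have "D r = A * sqrt (h r)"
      by (simp add: A_def D_eq[OF r(1)])
    moreover have "A * (1 - sqrt (h r)) \<le> 0"
      using hpos[OF r(2)] Hpos[OF r(2)] w_pos[of r] h_lt1[OF r(1)] r
      unfolding A_def by (intro mult_nonpos_nonneg divide_nonpos_pos) auto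
    ultimately show "- w r * H r / (h r * (1 - r)) - D r \<le> 0"
      unfolding A_def[symmetric] by (simp add: right_diff_distrib)
  qed (use that in \<open>auto simp: I\<close>)
  have half: "1 / 2 \<in> I"
    using m by (simp add: I)
  have \<Xi>_ge: "\<Xi> (1 / 2) - w (1 / 2) \<le> \<Xi> s" if "s \<in> I" for s
  proof (cases "s < 1 / 2")
    case True
    then show ?thesis
      using \<Xi>_less[OF that _ half] w_pos[of "1 / 2"] by simp
  next
    case False
    then show ?thesis
      using w_\<Xi>[OF half _ that] w_pos[of s] by simp
  qed
  \<comment> \<open>The height, normalised to tend to \<open>0\<close> as \<open>s\<close> tends to \<open>1\<close>.\<close>
  define \<xi> where "\<xi> = (\<lambda>s. \<Xi> s - Inf (\<Xi> ` I))"
  have \<xi>': "(\<xi> has_real_derivative D s) (at s)" if "s \<in> I" for s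
    unfolding \<xi>_def by (auto intro!: derivative_eq_intros \<Xi>'[OF that])
  have bdd: "bdd_below (\<Xi> ` I)"
    using \<Xi>_ge by (auto simp: bdd_below_def)
  have \<xi>_less: "\<xi> t < \<xi> s" if "s \<in> I" "s < t" "t \<in> I" for s t
    using \<Xi>_less[OF that] by (simp add: \<xi>_def)
  have \<xi>_pos: "\<xi> s > 0" if "s \<in> I" for s
  proof -
    have t: "(s + 1) / 2 \<in> I" "s < (s + 1) / 2"
      using that by (auto simp: I)
    then have "Inf (\<Xi> ` I) \<le> \<Xi> ((s + 1) / 2)"
      using bdd by (intro cInf_lower) auto
    then show ?thesis
      using \<Xi>_less[OF that t(2,1)] by (simp add: \<xi>_def)
  qed
  have \<xi>_small: "\<exists>s\<in>I. \<xi> s < \<epsilon>" if "\<epsilon> > 0" for \<epsilon>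
    using cInf_lessD[of "\<Xi> ` I" "Inf (\<Xi> ` I) + \<epsilon>"] half that by (force simp: \<xi>_def)
  \<comment> \<open>This is \<open>dx \<ge> exp c0 du / u\<close>: the height grows at least like the logarithm of \<open>u\<close>.\<close>
  have \<xi>_L: "\<xi> (1 / 2) - exp c0 * L (1 / 2) \<le> \<xi> s - exp c0 * L s" if "m < s" "s \<le> 1 / 2" for s
  proof (rule DERIV_nonpos_imp_nonincreasing[OF that(2)])
    fix t assume t: "s \<le> t" "t \<le> 1 / 2"
    then have tI: "t \<in> I"
      using that by (simp add: I)
    have "m < t"
      using t that by simp
    note pos = hpos[OF this] Hpos[OF this]
    define A where "A = - H t / (h t * (1 - t))"
    have "A * (w t * sqrt (h t) - exp c0) \<le> 0"
      using pos t w_sqrt_ge[OF \<open>m < t\<close> t(2)]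
      unfolding A_def by (intro mult_nonpos_nonneg divide_nonpos_pos) auto
    moreover have "D t = A * (w t * sqrt (h t))"
      by (simp add: A_def D_eq[OF tI])
    ultimately have "D t - exp c0 * (- H t / (h t * (1 - t))) \<le> 0"
      unfolding A_def[symmetric] by (simp add: right_diff_distrib mult.commute)
    then show "\<exists>y. ((\<lambda>s. \<xi> s - exp c0 * L s) has_real_derivative y) (at t) \<and> y \<le> 0"
      using DERIV_diff[OF \<xi>'[OF tI] DERIV_cmult[OF L'[OF tI], of "exp c0"]] by blast
  qed
  have \<xi>_large: "\<exists>s\<in>I. B < \<xi> s" for B
  proof -
    obtain s where s: "s \<in> I" "s \<le> 1 / 2"
      "(B - \<xi> (1 / 2) + exp c0 * L (1 / 2)) / exp c0 < L s"
      using L_large by blast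
    then have "B - \<xi> (1 / 2) + exp c0 * L (1 / 2) < exp c0 * L s"
      by (simp add: field_simps)
    then show ?thesis
      using \<xi>_L[of s] s by (intro bexI[of _ s]) (auto simp: I)
  qed
  have inj: "inj_on \<xi> I"
    by (rule linorder_inj_onI) (use \<xi>_less in fastforce)+
  have image: "\<xi> ` I = {0<..}"
  proof (intro equalityI subsetI)
    fix x :: real assume "x \<in> {0<..}"
    then obtain s t where st: "s \<in> I" "x < \<xi> s" "t \<in> I" "\<xi> t < x"
      using \<xi>_large[of x] \<xi>_small[of x] by auto
    have "continuous_on I \<xi>"
      using \<xi>' by (intro continuous_at_imp_continuous_on) (auto intro: DERIV_isCont)
    then have "connected (\<xi> ` I)"
      by (rule connected_continuous_image) (simp add: I_def)
    then show "x \<in> \<xi> ` I"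
      using connectedD_interval[of "\<xi> ` I" "\<xi> t" "\<xi> s" x] st by auto
  qed (use \<xi>_pos in auto)
  define s where "s = inv_into I \<xi>"
  have s: "s x \<in> I" "\<xi> (s x) = x" if "x > 0" for x
    using that unfolding s_def by (auto simp: image intro!: inv_into_into f_inv_into_f)
  have s': "(s has_real_derivative inverse (D (s x))) (at x)" if "x > 0" for x
    unfolding s_def
    by (rule DERIV_inv_into[of I \<xi> D]) (use \<xi>' D_neg inj image that in \<open>force simp: I_def\<close>)+
  have s_gt: "t < s x" if "t \<in> I" "0 < x" "x < \<xi> t" for t x
    using that \<xi>_less[OF s(1) _ that(1), of x] s(2)[of x] by (cases "s x = t") force+
  have s_lt: "s x < t" if "t \<in> I" "\<xi> t < x" for t x
  proof -
    have "x > 0"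
      using that \<xi>_pos[of t] by simp
    then show ?thesis
      using that \<xi>_less[OF that(1) _ s(1), of x] s(2)[of x] by (cases "s x = t") force+
  qed
  show thesis
  proof (rule that[of "\<lambda>x. w (s x)" s])
    fix x :: real assume x: "0 < x"
    note sx = s[OF x]
    show "0 < w (s x)"
      by (rule w_pos)
    show "s x \<in> {m<..<1}"
      using sx by (simp add: I_def)
    have pos: "m < s x" "s x < 1"
      using sx by (auto simp: I)
    have "inverse (D (s x)) = - (sqrt (h (s x)) * (1 - s x)) / (w (s x) * H (s x))"
      by (simp add: D_def)
    then show "(s has_real_derivative - (sqrt (h (s x)) * (1 - s x)) / (w (s x) * H (s x))) (at x)"
      using s'[OF x] by simp
    have "((\<lambda>x. w (s x)) has_real_derivative
        (- w (s x) * H (s x) / (h (s x) * (1 - s x))) * inverse (D (s x))) (at x)"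
      by (rule DERIV_chain2[OF w'[OF sx(1)] s'[OF x]])
    moreover have "(- w (s x) * H (s x) / (h (s x) * (1 - s x))) * inverse (D (s x)) = 1 / sqrt (h (s x))"
    proof -
      define A where "A = - H (s x) / (h (s x) * (1 - s x)) * w (s x)"
      have "D (s x) = A * sqrt (h (s x))"
        by (simp add: A_def D_eq[OF sx(1)])
      moreover have "A \<noteq> 0"
        using pos hpos[of "s x"] Hpos[of "s x"] w_pos[of "s x"] by (auto simp: A_def)
      moreover have "- w (s x) * H (s x) / (h (s x) * (1 - s x)) = A"
        by (simp add: A_def)
      ultimately show ?thesis
        by (simp add: divide_inverse mult.assoc[symmetric])
    qed
    ultimately show "((\<lambda>x. w (s x)) has_real_derivative 1 / sqrt (h (s x))) (at x)"
      by simp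
  next
    show "((\<lambda>x. w (s x)) \<longlongrightarrow> 0) (at_right 0)"
    proof (rule tendstoI)
      fix \<epsilon> :: real assume "\<epsilon> > 0"
      then obtain t where t: "t \<in> I" "w t < \<epsilon>"
        using w_small by blast
      have "dist (w (s x)) 0 < \<epsilon>" if "0 < x" "x < \<xi> t" for x
        using w_less[OF t(1) s_gt[OF t(1) that] s(1)[OF that(1)]] t(2) w_pos[of "s x"] by simp
      then show "\<forall>\<^sub>F x in at_right 0. dist (w (s x)) 0 < \<epsilon>"
        using \<xi>_pos[OF t(1)] unfolding eventually_at_right_field by blast
    qed
    show "(s \<longlongrightarrow> 1) (at_right 0)"
    proof (rule tendstoI)
      fix \<epsilon> :: real assume "\<epsilon> > 0"
      define t where "t = max (1 / 2) (1 - \<epsilon>)"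
      have t: "t \<in> I" "1 - \<epsilon> \<le> t"
        using m \<open>\<epsilon> > 0\<close> by (auto simp: t_def I)
      have "dist (s x) 1 < \<epsilon>" if "0 < x" "x < \<xi> t" for x
        using s_gt[OF t(1) that] s(1)[OF that(1)] t(2) by (simp add: I dist_real_def)
      then show "\<forall>\<^sub>F x in at_right 0. dist (s x) 1 < \<epsilon>"
        using \<xi>_pos[OF t(1)] unfolding eventually_at_right_field by blast
    qed
    fix t assume "t \<in> {m<..<1}"
    then have t: "t \<in> I"
      by (simp add: I_def)
    show "\<exists>x0>0. \<forall>x\<ge>x0. s x < t"
      using \<xi>_pos[OF t] s_lt[OF t] by (intro exI[of _ "\<xi> t + 1"]) auto
  qed
qed

text \<open>
  The quadrature applies to \<open>h(s) = f(s, 1, \<dots>, 1)\<close> on the ray of the slice that lies in the cone;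
  its end point \<open>m = - \<mu>\<^sub>\<Gamma>\<^sup>+\<close> is at least \<open>- 1\<close>, and \<open>h\<close> vanishes there.
  The slope is unbounded since \<open>s\<close> comes arbitrarily close to \<open>m\<close>.
\<close>

lemma nontrivial_profile_exists:
  fixes f :: "real ^ 'n::finite \<Rightarrow> real" and \<Gamma> :: "(real ^ 'n) set" and k :: 'n
  assumes pair: "normalized_admissible_pair f \<Gamma>" and mu: "mu_plus \<Gamma> \<le> 1"
  obtains u p s where "profile f \<Gamma> k u p s" "\<And>x. x > 0 \<Longrightarrow> s x < 1"
    "\<And>B. \<exists>x>0. B < p x" "\<exists>x0>0. \<forall>x\<ge>x0. s x \<le> 1 / 2"
proof -
  define m where "m = - mu_plus \<Gamma>"
  define h where "h = (\<lambda>s. f (slice k s))"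
  define H where "H = (\<lambda>s. pderivative k f (slice k s))"
  have cone: "admissible_cone \<Gamma>" and smooth: "smooth_on f \<Gamma>"
    using pair by (auto simp: normalized_admissible_pair_def)
  have m: "- 1 \<le> m" "m \<le> 0"
    using mu mu_plus_slice(3)[OF cone] by (auto simp: m_def)
  have slice_iff: "slice k s \<in> \<Gamma> \<longleftrightarrow> m < s" for s
    using mu_plus_slice(1)[OF cone] by (simp add: m_def)
  have slice_m: "slice k m \<in> frontier \<Gamma>"
    using mu_plus_slice(2)[OF cone] by (simp add: m_def)
  have h1: "h 1 = 1"
    using pair by (simp add: h_def slice_1 normalized_admissible_pair_def)
  have hm: "h m = 0"
    using pair slice_m by (simp add: h_def normalized_admissible_pair_def)
  have hpos: "h s > 0" and Hpos: "H s > 0" if "m < s" for s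
    using pair slice_iff[of s] that by (auto simp: h_def H_def normalized_admissible_pair_def)
  have h': "(h has_real_derivative H s) (at s)" if "m < s" for s
    using has_real_derivative_slice[OF smooth, of k s] slice_iff[of s] that
    by (simp add: h_def H_def)
  have Hcont: "isCont H s" if "m < s" for s
    using has_real_derivative_slice_funpow[OF smooth, of k s 1] slice_iff[of s] that DERIV_isCont
    by (auto simp: H_def)
  have hcont: "continuous_on {m..} h"
    unfolding h_def
  proof (rule continuous_on_compose2[of "closure \<Gamma>" f _ "slice k"])
    show "continuous_on (closure \<Gamma>) f"
      using pair by (simp add: normalized_admissible_pair_def)
    show "slice k ` {m..} \<subseteq> closure \<Gamma>"
    proof (rule image_subsetI)
      fix s assume "s \<in> {m..}"
      then consider "s = m" | "slice k s \<in> \<Gamma>"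
        using slice_iff by fastforce
      then show "slice k s \<in> closure \<Gamma>"
        using slice_m closure_subset[of \<Gamma>] by cases (auto simp: frontier_def)
    qed
  qed (rule continuous_on_slice)
  obtain u s where u_pos: "\<And>x. 0 < x \<Longrightarrow> 0 < u x"
    and s_in: "\<And>x. 0 < x \<Longrightarrow> s x \<in> {m<..<1}"
    and u': "\<And>x. 0 < x \<Longrightarrow> (u has_real_derivative 1 / sqrt (h (s x))) (at x)"
    and s': "\<And>x. 0 < x \<Longrightarrow>
      (s has_real_derivative - (sqrt (h (s x)) * (1 - s x)) / (u x * H (s x))) (at x)"
    and u_lim: "(u \<longlongrightarrow> 0) (at_right 0)" and s_lim: "(s \<longlongrightarrow> 1) (at_right 0)"
    and s_end: "\<And>t. t \<in> {m<..<1} \<Longrightarrow> \<exists>x0>0. \<forall>x\<ge>x0. s x < t"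
    using slope_equation_by_quadrature[OF m hcont hm h1 hpos Hpos Hcont h'] by metis
  define p where "p = (\<lambda>x. 1 / sqrt (h (s x)))"
  define v where "v = (\<lambda>x. if x \<le> 0 then 0 else u x)"
  have v_eq: "v x = u x" if "x > 0" for x
    using that by (simp add: v_def)
  have h_less: "h a < h b" if "m < a" "a < b" for a b
    using DERIV_pos_imp_increasing[of a b h] that h' Hpos by (meson less_le_trans)
  have hs: "0 < h (s x)" "h (s x) < 1" if "x > 0" for x
    using s_in[OF that] hpos[of "s x"] h_less[of "s x" 1] h1 by auto
  have "profile f \<Gamma> k v p s"
  proof
    show "(v \<longlongrightarrow> 0) (at_right 0)"
      by (rule tendsto_cong[THEN iffD1, OF _ u_lim])
        (auto simp: v_def eventually_at_filter)
    show "(p \<longlongrightarrow> 1) (at_right 0)"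
    proof -
      have "isCont h 1"
        using h'[of 1] m by (intro DERIV_isCont) auto
      then have "((\<lambda>x. h (s x)) \<longlongrightarrow> h 1) (at_right 0)"
        using s_lim by (rule isCont_tendsto_compose)
      then have "((\<lambda>x. 1 / sqrt (h (s x))) \<longlongrightarrow> 1 / sqrt (h 1)) (at_right 0)"
        by (intro tendsto_intros) (auto simp: h1)
      then show ?thesis
        by (simp add: p_def h1)
    qed
    fix x :: real assume x: "0 < x"
    show "0 < v x"
      using u_pos[OF x] v_eq[OF x] by simp
    show "1 \<le> p x"
      using hs[OF x] by (simp add: p_def)
    show "s x \<le> 1"
      using s_in[OF x] by simp
    show "slice k (s x) \<in> \<Gamma>"
      using s_in[OF x] by (simp add: slice_iff)
    show "(p x)\<^sup>2 * f (slice k (s x)) = 1"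
      using hs[OF x] by (simp add: p_def power_divide h_def)
    show "(v has_real_derivative p x) (at x)"
      using u'[OF x] unfolding p_def
      by (rule has_field_derivative_transform_within_open[of _ _ _ "{0<..}"]) (auto simp: x v_eq)
    show "(s has_real_derivative - (1 - s x) / (p x * v x * pderivative k f (slice k (s x)))) (at x)"
      using s'[OF x] by (simp add: p_def v_eq[OF x] H_def mult.commute del: minus_diff_eq)
    have "((\<lambda>x. h (s x)) has_real_derivative - (sqrt (h (s x)) * (1 - s x)) / u x) (at x)"
    proof -
      have "m < s x" "H (s x) \<noteq> 0"
        using s_in[OF x] Hpos[of "s x"] by auto
      then show ?thesis
        using DERIV_chain2[OF h'[OF \<open>m < s x\<close>] s'[OF x]] by simp
    qed
    moreover define q where "q = sqrt (h (s x))"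
    ultimately have "(p has_real_derivative - (- (q * (1 - s x)) / u x * (inverse q / 2)) / (q * q)) (at x)"
      unfolding p_def using hs[OF x] by (auto intro!: derivative_eq_intros simp: mult_ac)
    moreover have "- (- (q * (1 - s x)) / u x * (inverse q / 2)) / (q * q) = (1 / q)\<^sup>2 * (1 - s x) / (2 * u x)"
    proof -
      have "q \<noteq> 0"
        using hs[OF x] by (simp add: q_def)
      then show ?thesis
        by (simp add: power2_eq_square divide_simps)
    qed
    ultimately show "(p has_real_derivative (p x)\<^sup>2 * (1 - s x) / (2 * v x)) (at x)"
      by (simp add: p_def q_def v_eq[OF x])
  qed (use pair in \<open>auto simp: v_def\<close>)
  moreover have "\<exists>x>0. B < p x" for B :: real
  proof -
    define b where "b = max 1 B"
    define \<epsilon> where "\<epsilon> = 1 / b\<^sup>2"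
    have b: "b \<ge> 1" "B \<le> b"
      by (auto simp: b_def)
    have "(h \<longlongrightarrow> 0) (at m within {m..})"
      using hcont hm by (force simp: continuous_on_def)
    moreover have "\<epsilon> > 0"
      using b by (simp add: \<epsilon>_def)
    ultimately have "\<forall>\<^sub>F s in at_right m. h s < \<epsilon>"
      by (auto simp: at_within_Ici_at_right intro: order_tendstoD)
    moreover have "\<forall>\<^sub>F s in at_right m. s \<in> {m<..<1}"
      using m by (intro eventually_at_right_real) auto
    ultimately have "\<forall>\<^sub>F s in at_right m. h s < \<epsilon> \<and> s \<in> {m<..<1}"
      by (rule eventually_conj)
    from eventually_happens'[OF trivial_limit_at_right_real this]
    obtain t where t: "h t < \<epsilon>" "t \<in> {m<..<1}"
      by blast
    obtain x where x: "x > 0" "s x < t"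
      using s_end[OF t(2)] by blast
    then have "h (s x) < \<epsilon>"
      using h_less[of "s x" t] s_in[OF x(1)] t by auto
    then have "sqrt (h (s x)) < 1 / b"
      using b by (intro real_less_lsqrt) (auto simp: \<epsilon>_def power_divide)
    then have "b < p x"
      using hs[OF x(1)] b by (simp add: p_def pos_less_divide_eq mult.commute)
    then show ?thesis
      using x b by (intro exI[of _ x]) auto
  qed
  moreover have "\<exists>x0>0. \<forall>x\<ge>x0. s x \<le> 1 / 2"
    using s_end[of "1 / 2"] m by (auto intro: less_imp_le)
  ultimately show thesis
    using that s_in by simp
qed

section \<open>Geodesics of a metric that depends on one coordinate\<close>

lemma matrix_inv_scaleR_mat_1:
  assumes "a \<noteq> 0"
  shows "matrix_inv (a *\<^sub>R mat 1 :: real ^ 'n ^ 'n::finite) = (1 / a) *\<^sub>R mat 1"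
proof -
  let ?A = "a *\<^sub>R mat 1 :: real ^ 'n ^ 'n"
  have "?A ** ((1 / a) *\<^sub>R mat 1) = mat 1" "((1 / a) *\<^sub>R mat 1) ** ?A = mat 1"
    using assms by (simp_all add: matrix_scalar_ac)
  then have "?A ** matrix_inv ?A = mat 1 \<and> matrix_inv ?A ** ?A = mat 1"
    unfolding matrix_inv_def by (rule someI2[of _ "(1 / a) *\<^sub>R mat 1", OF conjI])
  then have "a *\<^sub>R matrix_inv ?A = mat 1"
    using scalar_matrix_assoc[of a "mat 1" "matrix_inv ?A"] by simp
  then have "(1 / a) *\<^sub>R a *\<^sub>R matrix_inv ?A = (1 / a) *\<^sub>R mat 1"
    by simp
  then show ?thesis
    using assms by simp
qed

lemma christoffel_conformal_coord:
  fixes x :: "real ^ 'n::finite"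
  assumes u: "(u has_real_derivative d) (at (x $ k))" and nz: "u (x $ k) \<noteq> 0"
  shows "christoffel (conformal_metric (\<lambda>x. u (x $ k))) x m i j =
    - (d / u (x $ k)) * (of_bool (i = k) * of_bool (j = m) + of_bool (j = k) * of_bool (i = m)
      - of_bool (m = k) * of_bool (i = j))"
proof -
  let ?g = "conformal_metric (\<lambda>x. u (x $ k)) :: real ^ 'n \<Rightarrow> real ^ 'n ^ 'n"
  let ?c = "u (x $ k)"
  have entry: "(\<lambda>y. ?g y $ a $ b) = (\<lambda>y. of_bool (a = b) / (u (y $ k))\<^sup>2)" for a b
    by (auto simp: conformal_metric_def mat_def)
  have pd: "pderivative l (\<lambda>y. ?g y $ a $ b) x = of_bool (l = k) * of_bool (a = b) * (- 2 * d / ?c ^ 3)"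
    for l a b
  proof -
    have "((\<lambda>t. of_bool (a = b) / (u t)\<^sup>2) has_real_derivative of_bool (a = b) * (- 2 * d / ?c ^ 3))
        (at (x $ k))"
      using nz by (auto intro!: derivative_eq_intros u simp: field_simps power2_eq_square power3_eq_cube)
    from pderivative_coord[OF this, of l] show ?thesis
      unfolding entry by auto
  qed
  have inv: "matrix_inv (?g x) $ m $ l = of_bool (m = l) * ?c\<^sup>2" for l
  proof -
    have "matrix_inv (?g x) = ?c\<^sup>2 *\<^sub>R mat 1"
      using nz by (simp add: conformal_metric_def matrix_inv_scaleR_mat_1)
    then show ?thesis
      by (simp add: mat_def)
  qed
  have "christoffel ?g x m i j = 1 / 2 * (\<Sum>l\<in>UNIV. if m = l then ?c\<^sup>2 * (- 2 * d / ?c ^ 3) *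
      (of_bool (i = k) * of_bool (j = l) + of_bool (j = k) * of_bool (i = l)
        - of_bool (l = k) * of_bool (i = j)) else 0)"
    unfolding christoffel_def inv pd by (intro arg_cong2[where f = "(*)"] refl sum.cong) (auto simp: algebra_simps)
  also have "\<dots> = 1 / 2 * (?c\<^sup>2 * (- 2 * d / ?c ^ 3) *
      (of_bool (i = k) * of_bool (j = m) + of_bool (j = k) * of_bool (i = m)
        - of_bool (m = k) * of_bool (i = j)))"
    by simp
  also have "1 / 2 * (?c\<^sup>2 * (- 2 * d / ?c ^ 3) * r) = - (d / ?c) * r" for r
    using nz by (simp add: power2_eq_square power3_eq_cube)
  finally show ?thesis .
qed

text \<open>
  With \<open>\<phi> = - ln w\<close>, the Christoffel symbols of \<open>exp (2 \<phi>) |dx|\<^sup>2\<close> are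
  \<open>\<delta>\<^sub>m\<^sub>i \<phi>\<^sub>j + \<delta>\<^sub>m\<^sub>j \<phi>\<^sub>i - \<delta>\<^sub>i\<^sub>j \<phi>\<^sub>m\<close>, and here only \<open>\<phi>\<^sub>k = - w' / w\<close> is nonzero.
\<close>

lemma geodesic_acceleration_coord:
  fixes x v :: "real ^ 'n::finite"
  assumes u: "(u has_real_derivative d) (at (x $ k))" and nz: "u (x $ k) \<noteq> 0"
  shows "(\<chi> m. - (\<Sum>i\<in>UNIV. \<Sum>j\<in>UNIV.
      christoffel (conformal_metric (\<lambda>x. u (x $ k))) x m i j * v $ i * v $ j)) =
    (d / u (x $ k)) *\<^sub>R ((2 * v $ k) *\<^sub>R v - (v \<bullet> v) *\<^sub>R axis k 1)"
proof -
  have ob: "of_bool (i = a) * y = (if i = a then y else 0)" for i a :: 'n and y :: real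
    by simp
  let ?q = "d / u (x $ k)"
  have "- (\<Sum>i\<in>UNIV. \<Sum>j\<in>UNIV. christoffel (conformal_metric (\<lambda>x. u (x $ k))) x m i j * v $ i * v $ j)
      = ?q * (2 * v $ k * v $ m - of_bool (m = k) * (v \<bullet> v))" for m
  proof -
    have "- (\<Sum>i\<in>UNIV. \<Sum>j\<in>UNIV. christoffel (conformal_metric (\<lambda>x. u (x $ k))) x m i j * v $ i * v $ j)
        = ?q * ((\<Sum>i\<in>UNIV. \<Sum>j\<in>UNIV. of_bool (i = k) * (of_bool (j = m) * (v $ i * v $ j)))
          + (\<Sum>i\<in>UNIV. \<Sum>j\<in>UNIV. of_bool (j = k) * (of_bool (i = m) * (v $ i * v $ j)))
          - of_bool (m = k) * (\<Sum>i\<in>UNIV. \<Sum>j\<in>UNIV. of_bool (i = j) * (v $ i * v $ j)))"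
      unfolding christoffel_conformal_coord[OF assms]
      by (simp only: sum_distrib_left sum_negf[symmetric] sum.distrib[symmetric]
          sum_subtractf[symmetric]) (intro sum.cong refl, simp only: algebra_simps)
    also have "(\<Sum>i\<in>UNIV. \<Sum>j\<in>UNIV. of_bool (i = k) * (of_bool (j = m) * (v $ i * v $ j))) = v $ k * v $ m"
      by (subst sum.swap) (simp add: ob)
    also have "(\<Sum>i\<in>UNIV. \<Sum>j\<in>UNIV. of_bool (j = k) * (of_bool (i = m) * (v $ i * v $ j))) = v $ k * v $ m"
      by (simp add: ob sum.delta)
    also have "(\<Sum>i\<in>UNIV. \<Sum>j\<in>UNIV. of_bool (i = j) * (v $ i * v $ j)) = v \<bullet> v"
      by (simp add: ob inner_vec_def)
    finally show ?thesis
      by (simp add: algebra_simps)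
  qed
  then show ?thesis
    by (simp add: vec_eq_iff axis_def)
qed

lemma lipschitz_on_if_continuous_derivative:
  fixes F :: "'a::euclidean_space \<Rightarrow> 'b::real_normed_vector"
  assumes "compact K" "convex K"
    and deriv: "\<And>x. x \<in> K \<Longrightarrow> (F has_derivative F' x) (at x within K)"
    and cont: "\<And>h. continuous_on K (\<lambda>x. F' x h)"
  shows "\<exists>L. L-lipschitz_on K F"
proof -
  have "compact ((\<lambda>x. \<Sum>b\<in>Basis. norm (F' x b)) ` K)"
    using \<open>compact K\<close> by (intro compact_continuous_image continuous_intros cont)
  then obtain B where B: "B > 0" "\<And>x. x \<in> K \<Longrightarrow> \<bar>\<Sum>b\<in>Basis. norm (F' x b)\<bar> \<le> B"
    by (auto dest!: compact_imp_bounded simp: bounded_pos)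
  have "onorm (F' x) \<le> B" if "x \<in> K" for x
    using onorm_componentwise[OF has_derivative_bounded_linear[OF deriv[OF that]]] B(2)[OF that]
    by linarith
  then have "B-lipschitz_on K F"
    using B(1) by (intro bounded_derivative_imp_lipschitz[OF deriv]) (auto intro: \<open>convex K\<close>)
  then show ?thesis
    by blast
qed

context profile
begin

definition acceleration :: "real ^ 'n \<Rightarrow> real ^ 'n \<Rightarrow> real ^ 'n" where
  "acceleration c v = (p (c $ k) / u (c $ k)) *\<^sub>R ((2 * v $ k) *\<^sub>R v - (v \<bullet> v) *\<^sub>R axis k 1)"

abbreviation profile_metric :: "real ^ 'n \<Rightarrow> real ^ 'n ^ 'n" where
  "profile_metric \<equiv> conformal_metric (\<lambda>x. u (x $ k))"

lemma geodesic_on_iff: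
  "geodesic_on profile_metric (half_space k) I c \<longleftrightarrow> c ` I \<subseteq> half_space k \<and>
    (\<exists>v. \<forall>t\<in>I. (c has_vector_derivative v t) (at t within I) \<and>
      (v has_vector_derivative acceleration (c t) (v t)) (at t within I))"
proof -
  have acc: "(\<chi> m. - (\<Sum>i\<in>UNIV. \<Sum>j\<in>UNIV. christoffel profile_metric x m i j * v $ i * v $ j)) = acceleration x v"
    if "x \<in> half_space k" for x v
    using geodesic_acceleration_coord[OF u_deriv[of "x $ k"], of v] u_pos[of "x $ k"] that
    by (simp add: acceleration_def half_space_def)
  then show ?thesis
    unfolding geodesic_on_def by (auto simp: image_subset_iff)
qed

lemma p_mono: "p x \<le> p y" if "0 < x" "x \<le> y"
proof (rule DERIV_nonneg_imp_nondecreasing[OF that(2)])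
  fix z assume "x \<le> z" "z \<le> y"
  then have "0 < z"
    using that by simp
  then show "\<exists>d. (p has_real_derivative d) (at z) \<and> 0 \<le> d"
    using p_deriv[of z] u_pos[of z] s_le[of z]
    by (intro exI[of _ "(p z)\<^sup>2 * (1 - s z) / (2 * u z)"]) auto
qed

lemma u_diff: "0 < x \<Longrightarrow> x < y \<Longrightarrow> \<exists>z. x < z \<and> z < y \<and> u y - u x = (y - x) * p z"
  by (rule MVT2) (auto intro: u_deriv)

text \<open>
  The slope is nondecreasing, at least \<open>1\<close>, and \<open>u\<close> tends to \<open>0\<close> at the boundary: compare \<open>u\<close> with the two
  lines through the origin. The upper bound is what makes the metric complete near the boundary, since it
  compares the metric with a multiple of the hyperbolic one.
\<close>

lemma u_bounds:
  assumes "0 < x"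
  shows "x \<le> u x" "u x \<le> x * p x"
proof -
  have ev: "\<forall>\<^sub>F y in at_right 0. y \<in> {0<..<x}"
    using assms by (rule eventually_at_right_real)
  have lim: "((\<lambda>y. u x - u y) \<longlongrightarrow> u x - 0) (at_right 0)"
    by (intro tendsto_intros u_tendsto)
  have "\<forall>\<^sub>F y in at_right 0. u x - u y \<le> (x - y) * p x \<and> x - y \<le> u x - u y"
    using ev
  proof eventually_elim
    case (elim y)
    then obtain z where z: "y < z" "z < x" "u x - u y = (x - y) * p z"
      using u_diff[of y x] by auto
    have "(x - y) * p z \<le> (x - y) * p x" "(x - y) * 1 \<le> (x - y) * p z"
      using z elim p_mono[of z x] p_ge[of z] by (intro mult_left_mono; simp)+
    then show ?case
      using z by simp
  qed
  then have "\<forall>\<^sub>F y in at_right 0. u x - u y \<le> (x - y) * p x" "\<forall>\<^sub>F y in at_right 0. x - y \<le> u x - u y"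
    by (auto elim: eventually_mono)
  moreover have "((\<lambda>y. (x - y) * p x) \<longlongrightarrow> (x - 0) * p x) (at_right 0)"
      "((\<lambda>y. x - y) \<longlongrightarrow> x - 0) (at_right 0)"
    by (intro tendsto_intros)+
  ultimately have "u x - 0 \<le> (x - 0) * p x" "x - 0 \<le> u x - 0"
    using lim tendsto_le[OF trivial_limit_at_right_real] by blast+
  then show "x \<le> u x" "u x \<le> x * p x"
    by simp_all
qed

lemma coord_has_real_derivative:
  assumes "(c has_vector_derivative v) (at t within I)"
  shows "((\<lambda>t. c t $ k) has_real_derivative v $ k) (at t within I)"
  using bounded_linear.has_vector_derivative[OF bounded_linear_vec_nth assms]
  by (simp add: has_real_derivative_iff_has_vector_derivative)

text \<open>
  Conservation of energy: by the geodesic equation the speed with respect to \<open>|dx|\<^sup>2 / u\<^sup>2\<close> is constant.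
\<close>

lemma geodesic_energy_constant:
  assumes "convex I" and c_pos: "\<And>t. t \<in> I \<Longrightarrow> c t $ k > 0"
    and c': "\<And>t. t \<in> I \<Longrightarrow> (c has_vector_derivative v t) (at t within I)"
    and v': "\<And>t. t \<in> I \<Longrightarrow> (v has_vector_derivative acceleration (c t) (v t)) (at t within I)"
  shows "\<exists>e\<ge>0. \<forall>t\<in>I. norm (v t) = e * u (c t $ k)"
proof -
  have "((\<lambda>t. (v t \<bullet> v t) / (u (c t $ k) * u (c t $ k))) has_real_derivative 0) (at t within I)" if t: "t \<in> I" for t
  proof -
    let ?a = "acceleration (c t) (v t)" and ?p = "p (c t $ k)" and ?u = "u (c t $ k)"
    have u: "((\<lambda>t. u (c t $ k)) has_real_derivative ?p * v t $ k) (at t within I)"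
      by (rule DERIV_chain'[OF coord_has_real_derivative[OF c'[OF t]] u_deriv[OF c_pos[OF t]]])
    have v: "((\<lambda>t. v t \<bullet> v t) has_real_derivative 2 * (v t \<bullet> ?a)) (at t within I)"
      using bounded_bilinear.has_vector_derivative[OF bounded_bilinear_inner v'[OF t] v'[OF t]]
      by (simp add: has_real_derivative_iff_has_vector_derivative inner_commute)
    have "?u \<noteq> 0"
      using u_pos[OF c_pos[OF t]] by simp
    then have "?u * ?u \<noteq> 0"
      by simp
    from DERIV_divide[OF v DERIV_mult[OF u u] this]
    have deriv: "((\<lambda>t. (v t \<bullet> v t) / (u (c t $ k) * u (c t $ k))) has_real_derivative
        (2 * (v t \<bullet> ?a) * (?u * ?u) - (v t \<bullet> v t) * (?p * v t $ k * ?u + ?p * v t $ k * ?u))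
          / (?u * ?u * (?u * ?u))) (at t within I)" .
    have "v t \<bullet> ?a = ?p / ?u * (v t $ k * (v t \<bullet> v t))"
      by (simp add: acceleration_def inner_diff_right inner_axis algebra_simps)
    then have "2 * (v t \<bullet> ?a) * (?u * ?u)
        - (v t \<bullet> v t) * (?p * v t $ k * ?u + ?p * v t $ k * ?u) = 0"
      using \<open>?u \<noteq> 0\<close> by simp
    then show ?thesis
      using deriv by (simp only: div_0)
  qed
  then obtain E where E: "\<And>t. t \<in> I \<Longrightarrow> (v t \<bullet> v t) / (u (c t $ k) * u (c t $ k)) = E"
    using has_field_derivative_zero_constant[OF \<open>convex I\<close>,
        of "\<lambda>t. (v t \<bullet> v t) / (u (c t $ k) * u (c t $ k))"] by blast
  have "norm (v t) = sqrt \<bar>E\<bar> * u (c t $ k)" if t: "t \<in> I" for t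
  proof -
    have u: "u (c t $ k) > 0"
      by (rule u_pos[OF c_pos[OF t]])
    have "E \<ge> 0"
      using E[OF t] by auto
    moreover have "v t \<bullet> v t = E * (u (c t $ k) * u (c t $ k))"
      using E[OF t] u by (simp add: field_simps)
    ultimately show ?thesis
      using u by (simp add: norm_eq_sqrt_inner real_sqrt_mult)
  qed
  then show ?thesis
    by (intro exI[of _ "sqrt \<bar>E\<bar>"]) auto
qed

text \<open>
  A curve whose Euclidean speed is at most proportional to its height loses height at most
  exponentially, so it does not reach the boundary in finite time.
\<close>

lemma geodesic_height_lower_bound:
  assumes "T > 0" and c_pos: "\<And>t. t \<in> {0..<T} \<Longrightarrow> c t $ k > 0"
    and c': "\<And>t. t \<in> {0..<T} \<Longrightarrow> (c has_vector_derivative v t) (at t within {0..<T})"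
    and slow: "\<And>t. t \<in> {0..<T} \<Longrightarrow> norm (v t) \<le> C * c t $ k" and "C \<ge> 0"
    and t: "t \<in> {0..<T}"
  shows "c 0 $ k * exp (- C * T) \<le> c t $ k"
proof -
  let ?g = "\<lambda>t. c t $ k * exp (C * t)"
  have g': "(?g has_real_derivative (v r $ k + C * c r $ k) * exp (C * r)) (at r within {0..<T})"
    if "r \<in> {0..<T}" for r
    by (auto intro!: derivative_eq_intros coord_has_real_derivative[OF c'[OF that]] simp: algebra_simps)
  have "?g 0 \<le> ?g t"
  proof (rule DERIV_nonneg_imp_increasing_open[where f = ?g])
    show "continuous_on {0..t} ?g"
    proof (rule continuous_on_subset)
      show "continuous_on {0..<T} ?g"
        using g' by (rule DERIV_continuous_on)
    qed (use t in auto)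
    fix r assume r: "0 < r" "r < t"
    then have "(?g has_real_derivative (v r $ k + C * c r $ k) * exp (C * r)) (at r within {0<..<T})"
      using t by (intro has_field_derivative_subset[OF g']) auto
    then have "(?g has_real_derivative (v r $ k + C * c r $ k) * exp (C * r)) (at r)"
      using r t by (subst (asm) at_within_open) auto
    moreover have "\<bar>v r $ k\<bar> \<le> C * c r $ k"
      using component_le_norm_cart[of "v r" k] slow[of r] r t by auto
    ultimately show "\<exists>y. (?g has_real_derivative y) (at r) \<and> 0 \<le> y"
      by (intro exI conjI) auto
  qed (use t in auto)
  then have "c 0 $ k \<le> c t $ k * exp (C * t)"
    by simp
  also have "\<dots> \<le> c t $ k * exp (C * T)"
    using c_pos[OF t] t \<open>C \<ge> 0\<close> by (auto intro!: mult_left_mono)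
  finally show ?thesis
    by (simp add: exp_minus field_simps)
qed

text \<open>
  The geodesic equation as a first-order system in phase space (position, velocity).
\<close>

definition geodesic_field :: "(real ^ 'n) \<times> (real ^ 'n) \<Rightarrow> (real ^ 'n) \<times> (real ^ 'n)" where
  "geodesic_field z = (snd z, acceleration (fst z) (snd z))"

lemma geodesic_field_locally_lipschitz:
  assumes z: "fst z $ k > 0"
  shows "\<exists>r>0. \<exists>L. cball z r \<subseteq> {z. fst z $ k > 0} \<and> L-lipschitz_on (cball z r) geodesic_field"
proof -
  define q where "q = (\<lambda>x. p x / u x)"
  define q' where "q' = (\<lambda>x. ((p x)\<^sup>2 * (1 - s x) / 2 - p x * p x) / (u x * u x))"
  define F' where "F' = (\<lambda>z h :: (real ^ 'n) \<times> (real ^ 'n).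
    (snd h, (q' (fst z $ k) * fst h $ k) *\<^sub>R ((2 * snd z $ k) *\<^sub>R snd z - (snd z \<bullet> snd z) *\<^sub>R axis k 1)
      + q (fst z $ k) *\<^sub>R ((2 * snd h $ k) *\<^sub>R snd z + (2 * snd z $ k) *\<^sub>R snd h
          - (2 * (snd z \<bullet> snd h)) *\<^sub>R axis k 1)))"
  let ?D = "{z :: (real ^ 'n) \<times> (real ^ 'n). fst z $ k > 0}"
  have q_deriv: "(q has_real_derivative q' x) (at x)" if "x > 0" for x
  proof -
    have nz: "u x \<noteq> 0"
      using u_pos[OF that] by simp
    show ?thesis
      unfolding q_def q'_def
      by (rule DERIV_cong[OF DERIV_divide[OF p_deriv[OF that] u_deriv[OF that] nz]]) (use nz in simp)
  qed
  have "isCont u x" "isCont p x" "isCont s x" if "x > 0" for x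
    using that u_deriv p_deriv s_deriv DERIV_isCont by blast+
  then have q_cont: "isCont q x" "isCont q' x" if "x > 0" for x
    using that u_pos[OF that] unfolding q_def q'_def by (auto intro!: continuous_intros)
  have "open ?D"
    by (intro open_Collect_less continuous_intros)
  then obtain r where r: "r > 0" "cball z r \<subseteq> ?D"
    using z open_contains_cball by blast
  have "\<exists>L. L-lipschitz_on (cball z r) geodesic_field"
  proof (rule lipschitz_on_if_continuous_derivative)
    fix y assume "y \<in> cball z r"
    then have y: "fst y $ k > 0"
      using r by auto
    have fst': "((\<lambda>z. fst z $ k) has_derivative (\<lambda>h. fst h $ k)) (at y)"
      and snd': "((\<lambda>z. snd z $ k) has_derivative (\<lambda>h. snd h $ k)) (at y)"
      by (intro bounded_linear_imp_has_derivative bounded_linear_compose[OF bounded_linear_vec_nth]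
          bounded_linear_fst bounded_linear_snd)+
    have q: "((\<lambda>z. q (fst z $ k)) has_derivative (\<lambda>h. q' (fst y $ k) * fst h $ k)) (at y)"
      by (rule has_derivative_compose[OF fst' q_deriv[OF y, unfolded has_field_derivative_def]])
    have snd: "(snd has_derivative snd) (at y)"
      by (rule has_derivative_snd[OF has_derivative_ident])
    have "((\<lambda>z. (2 * snd z $ k) *\<^sub>R snd z - (snd z \<bullet> snd z) *\<^sub>R axis k 1) has_derivative
        (\<lambda>h. (2 * snd h $ k) *\<^sub>R snd y + (2 * snd y $ k) *\<^sub>R snd h
          - (2 * (snd y \<bullet> snd h)) *\<^sub>R axis k 1)) (at y)"
      by (rule has_derivative_eq_rhs[OF has_derivative_diff[OF
            has_derivative_scaleR[OF has_derivative_mult_right[OF snd', of 2] snd]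
            has_derivative_scaleR[OF has_derivative_inner[OF snd snd] has_derivative_const]]])
        (auto simp: fun_eq_iff algebra_simps inner_commute)
    from has_derivative_Pair[OF snd has_derivative_scaleR[OF q this]]
    have "((\<lambda>z. (snd z, q (fst z $ k) *\<^sub>R ((2 * snd z $ k) *\<^sub>R snd z - (snd z \<bullet> snd z) *\<^sub>R axis k 1)))
        has_derivative F' y) (at y)"
      by (rule has_derivative_eq_rhs) (auto simp: F'_def fun_eq_iff add.commute)
    then have "(geodesic_field has_derivative F' y) (at y)"
      by (simp add: geodesic_field_def[abs_def] acceleration_def q_def)
    then show "(geodesic_field has_derivative F' y) (at y within cball z r)"
      by (rule has_derivative_at_withinI)
  next
    fix h
    have "continuous_on {0<..} q" "continuous_on {0<..} q'"
      using q_cont by (simp_all add: continuous_at_imp_continuous_on)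
    moreover have "continuous_on (cball z r) (\<lambda>z. fst z $ k)" "(\<lambda>z. fst z $ k) ` cball z r \<subseteq> {0<..}"
      using r by (auto intro!: continuous_intros)
    ultimately have "continuous_on (cball z r) (\<lambda>z. q (fst z $ k))"
      "continuous_on (cball z r) (\<lambda>z. q' (fst z $ k))"
      by (auto intro: continuous_on_compose2)
    then show "continuous_on (cball z r) (\<lambda>z. F' z h)"
      unfolding F'_def by (intro continuous_intros)
  qed auto
  then obtain L where "L-lipschitz_on (cball z r) geodesic_field"
    by blast
  then show ?thesis
    using r by blast
qed

end

section \<open>Local completeness near the boundary, and incompleteness\<close>

context profile
begin

text \<open>
  On a bounded set \<open>u\<close> is at most a multiple of the height, so by conservation of energy the geodesic stays at a
  positive height up to any finite time. It is then confined to a compact subset of the phase space and can be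
  continued, against maximality.
\<close>

lemma bounded_maximal_geodesic_is_complete:
  assumes max: "maximal_geodesic profile_metric (half_space k) T c"
    and bdd: "bounded (c ` time_interval T)"
  shows "T = \<infinity>"
proof (rule ccontr)
  assume "T \<noteq> \<infinity>"
  moreover have "T > 0"
    using max by (simp add: maximal_geodesic_def)
  ultimately obtain \<tau> where T: "T = ereal \<tau>" and \<tau>: "\<tau> > 0"
    by (cases T) auto
  have ti: "time_interval (ereal a) = {0..<a}" for a
    by (auto simp: time_interval_def)
  obtain v where c_half: "c ` {0..<\<tau>} \<subseteq> half_space k"
    and c': "\<And>t. t \<in> {0..<\<tau>} \<Longrightarrow> (c has_vector_derivative v t) (at t within {0..<\<tau>})"
    and v': "\<And>t. t \<in> {0..<\<tau>} \<Longrightarrow>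
      (v has_vector_derivative acceleration (c t) (v t)) (at t within {0..<\<tau>})"
    using max unfolding maximal_geodesic_def T ti geodesic_on_iff by blast
  have c_pos: "c t $ k > 0" if "t \<in> {0..<\<tau>}" for t
    using c_half that by (simp add: image_subset_iff half_space_def)
  obtain R where R: "R > 0" "\<And>t. t \<in> {0..<\<tau>} \<Longrightarrow> norm (c t) \<le> R"
    using bdd unfolding T ti by (auto simp: bounded_pos)
  have c_le: "c t $ k \<le> R" if "t \<in> {0..<\<tau>}" for t
    using component_le_norm_cart[of "c t" k] R(2)[OF that] by simp
  have "\<exists>e\<ge>0. \<forall>t\<in>{0..<\<tau>}. norm (v t) = e * u (c t $ k)"
    by (rule geodesic_energy_constant[OF _ c_pos c' v']) simp
  then obtain e where e: "e \<ge> 0" "\<And>t. t \<in> {0..<\<tau>} \<Longrightarrow> norm (v t) = e * u (c t $ k)"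
    by blast
  define C where "C = e * p R"
  have C: "C \<ge> 0"
    using e(1) p_ge[OF R(1)] by (simp add: C_def)
  have slow: "norm (v t) \<le> C * c t $ k" if "t \<in> {0..<\<tau>}" for t
  proof -
    have "u (c t $ k) \<le> c t $ k * p (c t $ k)"
      by (rule u_bounds[OF c_pos[OF that]])
    also have "\<dots> \<le> c t $ k * p R"
      using c_pos[OF that] p_mono[OF c_pos[OF that] c_le[OF that]] by (intro mult_left_mono) auto
    finally have "e * u (c t $ k) \<le> e * (c t $ k * p R)"
      using e(1) by (rule mult_left_mono)
    then show ?thesis
      by (simp add: e(2)[OF that] C_def mult_ac)
  qed
  define \<delta> where "\<delta> = c 0 $ k * exp (- C * \<tau>)"
  have "\<delta> > 0"
    using c_pos[of 0] \<tau> by (simp add: \<delta>_def)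
  have height: "\<delta> \<le> c t $ k" if "t \<in> {0..<\<tau>}" for t
    unfolding \<delta>_def by (rule geodesic_height_lower_bound[OF \<tau> c_pos c' slow C that])
  define K where "K = (cball 0 R \<inter> {x. \<delta> \<le> x $ k}) \<times> (cball 0 (C * R) :: (real ^ 'n) set)"
  have "compact K"
    unfolding K_def by (intro compact_Times compact_Int_closed closed_Collect_le continuous_intros) auto
  have "(c t, v t) \<in> K" if "t \<in> {0..<\<tau>}" for t
  proof -
    have "C * c t $ k \<le> C * R"
      using C c_le[OF that] by (rule mult_left_mono[rotated])
    then show ?thesis
      using R(2)[OF that] height[OF that] slow[OF that] by (simp add: K_def)
  qed
  moreover have "((\<lambda>t. (c t, v t)) has_vector_derivative geodesic_field (c t, v t)) (at t within {0..<\<tau>})"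
    if "t \<in> {0..<\<tau>}" for t
    using has_vector_derivative_Pair[OF c'[OF that] v'[OF that]] by (simp add: geodesic_field_def)
  ultimately obtain \<tau>' z where \<tau>': "\<tau>' > \<tau>" and z_ext: "\<forall>t\<in>{0..<\<tau>}. z t = (c t, v t)"
    and z: "\<forall>t\<in>{0..<\<tau>'}. z t \<in> {z. fst z $ k > 0} \<and>
      (z has_vector_derivative geodesic_field (z t)) (at t within {0..<\<tau>'})"
    using ode_solution_extends[OF \<open>compact K\<close> geodesic_field_locally_lipschitz \<tau>,
        of "\<lambda>t. (c t, v t)"] \<open>\<delta> > 0\<close>
    by (force simp: K_def)
  have z1: "((\<lambda>t. fst (z t)) has_vector_derivative snd (z t)) (at t within {0..<\<tau>'})"
    and z2: "((\<lambda>t. snd (z t)) has_vector_derivative acceleration (fst (z t)) (snd (z t))) (at t within {0..<\<tau>'})"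
    if "t \<in> {0..<\<tau>'}" for t
    using bounded_linear.has_vector_derivative[OF bounded_linear_fst, of z "geodesic_field (z t)"]
      bounded_linear.has_vector_derivative[OF bounded_linear_snd, of z "geodesic_field (z t)"] z that
    by (auto simp: geodesic_field_def)
  have "geodesic_on profile_metric (half_space k) (time_interval (ereal \<tau>')) (\<lambda>t. fst (z t))"
    unfolding geodesic_on_iff ti using z z1 z2
    by (intro conjI exI[of _ "\<lambda>t. snd (z t)"]) (auto simp: half_space_def)
  moreover have "\<forall>t\<in>time_interval T. fst (z t) = c t"
    using z_ext by (simp add: T ti)
  moreover have "T < ereal \<tau>'"
    using \<tau>' by (simp add: T)
  ultimately show False
    using max unfolding maximal_geodesic_def by blast
qed

theorem locally_complete: "locally_complete_near_boundary profile_metric (half_space k)"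
  unfolding locally_complete_near_boundary_def
  using bounded_maximal_geodesic_is_complete bounded_subset by blast

text \<open>
  The vertical line, parametrised by arc length, is a geodesic. Its length from the height \<open>x0\<close> on is
  \<open>\<integral> dx / u\<close>. As soon as \<open>s \<le> 1 / 2\<close>, the derivative \<open>(1 / p)' = - (1 - s) / (2 u)\<close> is at most
  \<open>- 1 / (4 u)\<close>, which bounds the length by \<open>4 / p x0\<close>. So this geodesic escapes to infinity in finite time.
\<close>

theorem incomplete:
  assumes slow: "\<exists>x0>0. \<forall>x\<ge>x0. s x \<le> 1 / 2"
  shows "\<not> complete_metric profile_metric (half_space k)"
proof -
  obtain x0 where x0: "x0 > 0" and s_half: "\<And>x. x \<ge> x0 \<Longrightarrow> s x \<le> 1 / 2"
    using slow by blast
  have "isCont u x" if "x > 0" for x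
    using u_deriv[OF that] by (rule DERIV_isCont)
  then obtain \<Theta> where "\<forall>x. 0 < ereal x \<longrightarrow> ereal x < \<infinity> \<longrightarrow> (\<Theta> has_vector_derivative 1 / u x) (at x)"
    using einterval_antiderivative[of 0 \<infinity> "\<lambda>x. 1 / u x"] u_pos
    by (force intro!: continuous_intros)
  then have \<Theta>: "(\<Theta> has_real_derivative 1 / u x) (at x)" if "x > 0" for x
    using that by (simp add: has_real_derivative_iff_has_vector_derivative)
  \<comment> \<open>The signed arc length along the vertical line, measured from \<open>x0\<close>.\<close>
  define \<theta> where "\<theta> = (\<lambda>x. \<Theta> x - \<Theta> x0)"
  have \<theta>: "(\<theta> has_real_derivative 1 / u x) (at x)" if "x > 0" for x
    unfolding \<theta>_def by (auto intro!: derivative_eq_intros \<Theta>[OF that])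
  have \<theta>_less: "\<theta> x < \<theta> y" if "0 < x" "x < y" for x y
  proof (rule DERIV_pos_imp_increasing[OF that(2)])
    fix z assume "x \<le> z" "z \<le> y"
    then have "0 < z"
      using that by simp
    then show "\<exists>d. (\<theta> has_real_derivative d) (at z) \<and> 0 < d"
      using \<theta>[of z] u_pos[of z] by (intro exI[of _ "1 / u z"]) simp
  qed
  have \<theta>_bound: "\<theta> x \<le> \<theta> x0 + 4 / p x0" if "x0 \<le> x" for x
  proof -
    have "\<theta> x + 4 / p x \<le> \<theta> x0 + 4 / p x0"
    proof (rule DERIV_nonpos_imp_nonincreasing[OF that])
      fix z assume z: "x0 \<le> z" "z \<le> x"
      then have "z > 0"
        using x0 by simp
      note pos = u_pos[OF this] p_ge[OF this]
      have nz: "p z \<noteq> 0"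
        using pos by simp
      have "((\<lambda>x. 4 / p x) has_real_derivative
          (0 * p z - 4 * ((p z)\<^sup>2 * (1 - s z) / (2 * u z))) / (p z * p z)) (at z)"
        by (rule DERIV_divide[OF DERIV_const p_deriv[OF \<open>z > 0\<close>] nz])
      from DERIV_add[OF \<theta>[OF \<open>z > 0\<close>] this]
      have "((\<lambda>x. \<theta> x + 4 / p x) has_real_derivative
          1 / u z + (0 * p z - 4 * ((p z)\<^sup>2 * (1 - s z) / (2 * u z))) / (p z * p z)) (at z)" .
      moreover have "1 / u z + (0 * p z - 4 * ((p z)\<^sup>2 * (1 - s z) / (2 * u z))) / (p z * p z)
          = (2 * s z - 1) / u z"
        using pos nz by (simp add: power2_eq_square field_simps)
      moreover have "(2 * s z - 1) / u z \<le> 0"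
        using pos s_half[OF z(1)] by (intro divide_nonpos_pos) auto
      ultimately show "\<exists>y. ((\<lambda>x. \<theta> x + 4 / p x) has_real_derivative y) (at z) \<and> y \<le> 0"
        by auto
    qed
    then show ?thesis
      using p_ge[of x] x0 that by (smt (verit) divide_nonneg_pos)
  qed
  have bdd: "bdd_above (\<theta> ` {0<..})"
  proof (rule bdd_aboveI2)
    fix x :: real assume x: "x \<in> {0<..}"
    show "\<theta> x \<le> \<theta> x0 + 4 / p x0"
      using \<theta>_bound[of x] \<theta>_less[of x x0] x p_ge[OF x0] by (cases "x0 \<le> x") (auto simp: less_imp_le add_increasing2)
  qed
  define \<tau> where "\<tau> = Sup (\<theta> ` {0<..})"
  have below: "\<theta> x < \<tau>" if "x > 0" for x
  proof -
    have "\<theta> (x + 1) \<le> \<tau>"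
      unfolding \<tau>_def using that bdd by (intro cSup_upper) auto
    then show ?thesis
      using \<theta>_less[of x "x + 1"] that by simp
  qed
  have \<theta>0: "\<theta> x0 = 0"
    by (simp add: \<theta>_def)
  then have \<tau>: "\<tau> > 0"
    using below[OF x0] by simp
  have inj: "inj_on \<theta> {0<..}"
    by (rule linorder_inj_onI) (use \<theta>_less in fastforce)+
  have image: "{0..<\<tau>} \<subseteq> \<theta> ` {0<..}"
  proof
    fix t assume t: "t \<in> {0..<\<tau>}"
    then obtain x where "x > 0" "t < \<theta> x"
      using less_cSupD[of "\<theta> ` {0<..}" t] unfolding \<tau>_def by auto
    moreover have "connected (\<theta> ` {0<..})"
      using \<theta> by (intro connected_continuous_image continuous_at_imp_continuous_on)
        (auto intro: DERIV_isCont)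
    ultimately show "t \<in> \<theta> ` {0<..}"
      using connectedD_interval[of "\<theta> ` {0<..}" "\<theta> x0" "\<theta> x" t] x0 t \<theta>0 by auto
  qed
  \<comment> \<open>The height as a function of arc length.\<close>
  define y where "y = inv_into {0<..} \<theta>"
  have y_pos: "y t > 0" if "t \<in> {0..<\<tau>}" for t
    using inv_into_into[of t \<theta> "{0<..}"] image that by (auto simp: y_def)
  have y_\<theta>: "y (\<theta> x) = x" if "x > 0" for x
    using inj that by (simp add: y_def)
  have y': "(y has_real_derivative u (y t)) (at t)" if "t \<in> {0..<\<tau>}" for t
  proof -
    have "(y has_real_derivative inverse (1 / u (y t))) (at t)"
      unfolding y_def
    proof (rule DERIV_inv_into[OF _ _ _ inj])
      show "t \<in> \<theta> ` {0<..}"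
        using image that by blast
    qed (use u_pos \<theta> in force)+
    then show ?thesis
      by simp
  qed
  define c where "c = (\<lambda>t. y t *\<^sub>R (axis k 1 :: real ^ 'n))"
  have ti: "time_interval (ereal a) = {0..<a}" for a
    by (auto simp: time_interval_def)
  have "geodesic_on profile_metric (half_space k) {0..<\<tau>} c"
    unfolding geodesic_on_iff
  proof (intro conjI exI[of _ "\<lambda>t. u (y t) *\<^sub>R axis k 1"] ballI image_subsetI)
    fix t assume t: "t \<in> {0..<\<tau>}"
    show "c t \<in> half_space k"
      using y_pos[OF t] by (simp add: c_def half_space_def)
    have "(c has_vector_derivative u (y t) *\<^sub>R axis k 1) (at t)"
      using has_vector_derivative_scaleR[OF y'[OF t] has_vector_derivative_const[of "axis k 1 :: real ^ 'n"]]
      by (simp add: c_def)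
    then show "(c has_vector_derivative u (y t) *\<^sub>R axis k 1) (at t within {0..<\<tau>})"
      by (rule has_vector_derivative_at_within)
    have "((\<lambda>t. u (y t)) has_real_derivative p (y t) * u (y t)) (at t)"
      by (rule DERIV_chain2[OF u_deriv[OF y_pos[OF t]] y'[OF t]])
    from has_vector_derivative_scaleR[OF this has_vector_derivative_const[of "axis k 1 :: real ^ 'n"]]
    have "((\<lambda>t. u (y t) *\<^sub>R (axis k 1 :: real ^ 'n)) has_vector_derivative
        (p (y t) * u (y t)) *\<^sub>R axis k 1) (at t)"
      by simp
    moreover have "acceleration (c t) (u (y t) *\<^sub>R axis k 1) = (p (y t) * u (y t)) *\<^sub>R axis k 1"
      using u_pos[OF y_pos[OF t]]
      by (simp add: acceleration_def c_def inner_axis_axis algebra_simps flip: scaleR_left_diff_distrib)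
    ultimately show "((\<lambda>t. u (y t) *\<^sub>R axis k 1) has_vector_derivative
        acceleration (c t) (u (y t) *\<^sub>R axis k 1)) (at t within {0..<\<tau>})"
      by (simp add: has_vector_derivative_at_within)
  qed
  moreover have False if ext: "ereal \<tau> < T'" "geodesic_on profile_metric (half_space k) (time_interval T') c'"
    "\<forall>t\<in>{0..<\<tau>}. c' t = c t" for T' c'
  proof -
    have "continuous_on (time_interval T') c'"
      using ext(2) unfolding geodesic_on_def by (auto intro: continuous_on_vector_derivative)
    moreover have "{0..\<tau>} \<subseteq> time_interval T'"
      using ext(1) by (auto simp: time_interval_def intro: le_less_trans[of _ "ereal \<tau>"])
    ultimately have "compact (c' ` {0..\<tau>})"
      by (intro compact_continuous_image) (auto intro: continuous_on_subset)
    then have "bounded (c' ` {0..\<tau>})"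
      by (rule compact_imp_bounded)
    then obtain B where B: "\<forall>t\<in>{0..\<tau>}. norm (c' t) \<le> B"
      by (auto simp: bounded_iff)
    define x where "x = max x0 (B + 1)"
    have x: "x \<ge> x0" "x > B" "x > 0"
      using x0 by (auto simp: x_def)
    have "\<theta> x \<ge> 0"
      using \<theta>_less[OF x0, of x] \<theta>0 x by (cases "x = x0") auto
    then have t: "\<theta> x \<in> {0..<\<tau>}"
      using below x by simp
    then have "norm (c' (\<theta> x)) = x"
      using ext(3) x by (simp add: c_def y_\<theta> norm_axis_1)
    moreover have "norm (c' (\<theta> x)) \<le> B"
      using B t by simp
    ultimately show False
      using x by simp
  qed
  ultimately have "maximal_geodesic profile_metric (half_space k) (ereal \<tau>) c"
    using \<tau> unfolding maximal_geodesic_def ti by auto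
  then show ?thesis
    unfolding complete_metric_def by (metis PInfty_neq_ereal(1))
qed

end

section \<open>The one-parameter family\<close>

context profile
begin

lemma u_has_derivative_at_0: "(u has_real_derivative 1) (at 0 within {0..})"
proof -
  have pos: "\<forall>\<^sub>F x in at_right (0::real). x > 0"
    by (simp add: eventually_at_filter)
  have "((\<lambda>x. u x / x) \<longlongrightarrow> 1) (at_right 0)"
  proof (rule real_tendsto_sandwich[OF _ _ tendsto_const p_tendsto])
    show "\<forall>\<^sub>F x in at_right 0. 1 \<le> u x / x"
      using pos by eventually_elim (use u_bounds(1) in \<open>simp add: field_simps\<close>)
    show "\<forall>\<^sub>F x in at_right 0. u x / x \<le> p x"
      using pos by eventually_elim (use u_bounds(2) in \<open>simp add: field_simps\<close>)
  qed
  then show ?thesis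
    by (simp add: has_field_derivative_iff u_0 at_within_Ici_at_right)
qed

lemma one_le_ratio: "0 < x \<Longrightarrow> 1 \<le> u x / x"
  using u_bounds(1)[of x] by simp

lemma deriv_u: "0 < x \<Longrightarrow> deriv u x = p x"
  by (rule DERIV_imp_deriv[OF u_deriv])

lemma deriv_deriv_u_nonneg:
  assumes "0 < x"
  shows "0 \<le> deriv (deriv u) x"
proof -
  have "(deriv u has_real_derivative (p x)\<^sup>2 * (1 - s x) / (2 * u x)) (at x)"
    by (rule has_field_derivative_transform_within_open[OF p_deriv[OF assms], of "{0<..}"])
      (use assms in \<open>auto simp: deriv_u\<close>)
  then have "deriv (deriv u) x = (p x)\<^sup>2 * (1 - s x) / (2 * u x)"
    by (rule DERIV_imp_deriv)
  then show ?thesis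
    using s_le[OF assms] u_pos[OF assms] by simp
qed

text \<open>
  Strict convexity of \<open>u\<close> together with \<open>u(0) = 0\<close>.
\<close>

lemma ratio_less:
  assumes s_less: "\<And>x. 0 < x \<Longrightarrow> s x < 1" and xy: "0 < x" "x < y"
  shows "u x / x < u y / y"
proof -
  obtain z where z: "x < z" "u y - u x = (y - x) * p z"
    using u_diff[OF xy] by auto
  have "p x < p z"
  proof (rule DERIV_pos_imp_increasing[OF z(1)])
    fix t assume "x \<le> t" "t \<le> z"
    then have "0 < t"
      using xy by simp
    then have "0 < (p t)\<^sup>2 * (1 - s t) / (2 * u t)"
      using s_less[of t] u_pos[of t] p_ge[of t] by auto
    then show "\<exists>d. (p has_real_derivative d) (at t) \<and> 0 < d"
      using p_deriv[OF \<open>0 < t\<close>] by blast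
  qed
  moreover have "u x / x \<le> p x"
    using u_bounds(2)[OF xy(1)] xy by (simp add: field_simps)
  ultimately have "u x / x < p z"
    by simp
  then have "(y - x) * (u x / x) < u y - u x"
    unfolding z(2) using xy by (intro mult_strict_left_mono) auto
  moreover have "(y - x) * (u x / x) = y * (u x / x) - u x"
    using xy by (simp add: field_simps)
  ultimately have "y * (u x / x) < u y"
    by simp
  then show ?thesis
    using xy by (simp add: pos_less_divide_eq mult.commute)
qed

text \<open>
  The ratio lies below the slope, which tends to \<open>1\<close> at the boundary; and
  \<open>u(2 x) \<ge> x p(x)\<close> bounds it below by half of a slope, which can be made as large as desired.
\<close>

lemma ratio_surj:
  assumes p_unbounded: "\<And>B. \<exists>x>0. B < p x" and "a > 0"
  shows "\<exists>x>0. u x / x = 1 + a"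
proof -
  have "\<forall>\<^sub>F x in at_right 0. p x < 1 + a"
    using p_tendsto \<open>a > 0\<close> by (intro order_tendstoD) auto
  moreover have "\<forall>\<^sub>F x in at_right (0::real). x > 0"
    by (simp add: eventually_at_filter)
  ultimately have "\<forall>\<^sub>F x in at_right (0::real). p x < 1 + a \<and> x > 0"
    by (rule eventually_conj)
  from eventually_happens'[OF trivial_limit_at_right_real this]
  obtain x1 where x1: "p x1 < 1 + a" "x1 > 0"
    by blast
  have "u x1 / x1 \<le> p x1"
    using u_bounds(2)[OF x1(2)] x1(2) by (simp add: field_simps)
  then have "u x1 / x1 < 1 + a"
    using x1(1) by simp
  obtain x where x: "x > 0" "2 * (1 + a) < p x"
    using p_unbounded by blast
  obtain z where z: "x < z" "u (2 * x) - u x = (2 * x - x) * p z"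
    using u_diff[of x "2 * x"] x by auto
  have "x * (2 * (1 + a)) < x * p z"
    using x p_mono[of x z] z by (intro mult_strict_left_mono) auto
  moreover have "u (2 * x) = u x + x * p z"
    using z(2) by simp
  moreover have "(2 * x) * (1 + a) = x * (2 * (1 + a))"
    by simp
  ultimately have "(2 * x) * (1 + a) < u (2 * x)"
    using u_pos[OF x(1)] by linarith
  then have "1 + a < u (2 * x) / (2 * x)"
    using x by (simp add: field_simps)
  have "isCont (\<lambda>x. u x / x) x" if "x > 0" for x
    using DERIV_isCont[OF u_deriv[OF that]] that by (intro continuous_intros) auto
  then have "connected ((\<lambda>x. u x / x) ` {0<..})"
    by (intro connected_continuous_image continuous_at_imp_continuous_on) auto
  from connectedD_interval[OF this, of "u x1 / x1" "u (2 * x) / (2 * x)" "1 + a"]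
  show ?thesis
    using x x1 \<open>u x1 / x1 < 1 + a\<close> \<open>1 + a < u (2 * x) / (2 * x)\<close> by auto
qed

end

theorem theorem1p1:
  fixes f :: "real ^ 'n::finite \<Rightarrow> real" and \<Gamma> :: "(real ^ 'n) set" and k :: 'n
  assumes "CARD('n) \<ge> 3"
    and "normalized_admissible_pair f \<Gamma>"
    and "concave_on \<Gamma> f"
    and "mu_plus \<Gamma> \<le> 1"
  shows "\<exists>W :: real \<Rightarrow> real \<Rightarrow> real.
      (\<forall>a\<ge>0. smooth_positive_solution f \<Gamma> k (\<lambda>x. W a (x $ k)))
    \<and> (\<forall>t\<ge>0. W 0 t = t)
    \<and> (\<forall>a\<ge>0. W a 1 = 1 + a)
    \<and> (\<forall>a\<ge>0. (\<forall>t>0. deriv (W a) t \<ge> 1) \<and> (\<forall>t\<ge>0. W a t \<ge> t) \<and>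
             (W a has_real_derivative 1) (at 0 within {0..}))
    \<and> (\<forall>a\<ge>0. \<forall>t>0. deriv (deriv (W a)) t \<ge> 0)
    \<and> (\<forall>a b. 0 \<le> a \<and> a < b \<longrightarrow> (\<forall>t>0. W a t < W b t))
    \<and> (\<forall>a\<ge>0. locally_complete_near_boundary
             (conformal_metric (\<lambda>x. W a (x $ k))) (half_space k))
    \<and> (\<forall>a>0. \<not> complete_metric
             (conformal_metric (\<lambda>x. W a (x $ k))) (half_space k))"
proof -
  obtain u p s where prof: "profile f \<Gamma> k u p s" and s_less: "\<And>x. x > 0 \<Longrightarrow> s x < 1"
    and p_unbounded: "\<And>B. \<exists>x>0. B < p x" and s_half: "\<exists>x0>0. \<forall>x\<ge>x0. s x \<le> 1 / 2"
    using nontrivial_profile_exists[OF assms(2,4)] by metis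
  interpret profile f \<Gamma> k u p s
    by (rule prof)
  \<comment> \<open>The dilation by \<open>r a\<close> normalises the solution to the value \<open>1 + a\<close> at \<open>1\<close>.\<close>
  obtain r where r: "\<And>a. a > 0 \<Longrightarrow> r a > 0" "\<And>a. a > 0 \<Longrightarrow> u (r a) / r a = 1 + a"
    using ratio_surj[OF p_unbounded] by metis
  define W where "W = (\<lambda>a t. if a = 0 then t else u (r a * t) / r a)"
  have W_0: "W 0 = (\<lambda>t. t)"
    by (simp add: W_def)
  have W_pos: "W a = (\<lambda>t. u (r a * t) / r a)" if "a > 0" for a
    using that by (simp add: W_def)
  have W_profile: "\<exists>P S. profile f \<Gamma> k (W a) P S" if "a \<ge> 0" for a
  proof (cases "a = 0")
    case True
    then show ?thesis
      using profile_id[OF assms(2), of k]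
      by (intro exI[of _ "\<lambda>_. 1"]) (simp add: W_0)
  next
    case False
    then show ?thesis
      using profile_scale[OF r(1)[of a]] W_pos[of a] that
      by (intro exI[of _ "\<lambda>x. p (r a * x)"] exI[of _ "\<lambda>x. s (r a * x)"]) simp
  qed
  have W_ratio: "W a t = t * (u (r a * t) / (r a * t))" if "a > 0" "t > 0" for a t
    using r(1)[OF that(1)] that by (simp add: W_def)
  have r_less: "r a < r b" if "0 < a" "a < b" for a b
  proof (rule ccontr)
    assume "\<not> r a < r b"
    then consider "r b = r a" | "r b < r a"
      by linarith
    then have "u (r b) / r b \<le> u (r a) / r a"
      using ratio_less[OF s_less, of "r b" "r a"] r(1)[of b] that by cases auto
    then show False
      using r(2)[of a] r(2)[of b] that by simp
  qed
  have W_less: "W a t < W b t" if "0 \<le> a" "a < b" "t > 0" for a b t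
  proof -
    have b: "b > 0"
      using that by simp
    show ?thesis
    proof (cases "a = 0")
      case True
      have "0 < r b * t / 2"
        using r(1)[OF b] that by simp
      then have "1 \<le> u (r b * t / 2) / (r b * t / 2)"
        by (rule one_le_ratio)
      also have "\<dots> < u (r b * t) / (r b * t)"
        using r(1)[OF b] that by (intro ratio_less s_less) auto
      finally show ?thesis
        using mult_strict_left_mono[of 1 "u (r b * t) / (r b * t)" t] that
        by (simp add: W_ratio[OF b] True W_0)
    next
      case False
      then have a: "a > 0"
        using that by simp
      have "u (r a * t) / (r a * t) < u (r b * t) / (r b * t)"
        using r_less[OF a that(2)] r(1)[OF a] that by (intro ratio_less s_less) auto
      then show ?thesis
        unfolding W_ratio[OF a that(3)] W_ratio[OF b that(3)]
        by (intro mult_strict_left_mono that(3))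
    qed
  qed
  show ?thesis
  proof (intro exI[of _ W] conjI allI impI)
    fix a :: real assume a: "a \<ge> 0"
    obtain P S where PS: "profile f \<Gamma> k (W a) P S"
      using W_profile[OF a] by (elim exE)
    interpret Wa: profile f \<Gamma> k "W a" P S
      by (rule PS)
    show "smooth_positive_solution f \<Gamma> k (\<lambda>x. W a (x $ k))"
      by (rule Wa.smooth_positive_solution)
    show "locally_complete_near_boundary (conformal_metric (\<lambda>x. W a (x $ k))) (half_space k)"
      by (rule Wa.locally_complete)
    show "(W a has_real_derivative 1) (at 0 within {0..})"
      by (rule Wa.u_has_derivative_at_0)
    show "W a 1 = 1 + a"
      using a r(2)[of a] by (cases "a = 0") (auto simp: W_def)
    show "deriv (W a) t \<ge> 1" if "t > 0" for t
      using Wa.deriv_u[OF that] Wa.p_ge[OF that] by simp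
    show "deriv (deriv (W a)) t \<ge> 0" if "t > 0" for t
      by (rule Wa.deriv_deriv_u_nonneg[OF that])
    show "W a t \<ge> t" if "t \<ge> 0" for t
      using Wa.u_bounds(1)[of t] Wa.u_0 that by (cases "t = 0") auto
  next
    fix a :: real assume a: "a > 0"
    interpret Wa: profile f \<Gamma> k "\<lambda>x. u (r a * x) / r a" "\<lambda>x. p (r a * x)" "\<lambda>x. s (r a * x)"
      by (rule profile_scale[OF r(1)[OF a]])
    obtain x0 where x0: "x0 > 0" "\<And>x. x \<ge> x0 \<Longrightarrow> s x \<le> 1 / 2"
      using s_half by blast
    have "s (r a * x) \<le> 1 / 2" if "x \<ge> x0 / r a" for x
      using that r(1)[OF a] by (intro x0(2)) (simp add: pos_divide_le_eq mult.commute)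
    moreover have "x0 / r a > 0"
      using x0(1) r(1)[OF a] by simp
    ultimately have "\<exists>x1>0. \<forall>x\<ge>x1. s (r a * x) \<le> 1 / 2"
      by blast
    then show "\<not> complete_metric (conformal_metric (\<lambda>x. W a (x $ k))) (half_space k)"
      unfolding W_pos[OF a] by (rule Wa.incomplete)
  next
    fix t :: real
    show "W 0 t = t"
      by (simp add: W_0)
  next
    fix a b t :: real assume "0 \<le> a \<and> a < b" "t > 0"
    then show "W a t < W b t"
      by (intro W_less) auto
  qed
qed

end
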